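(* Let $P_0,P_1$ be probability distributions on $\mathcal{X}$ and let $\alpha\in(0,1)$. For any $\varepsilon\ge0$ and $\delta\in[0,1]$, $$\lim_{n\to\infty}\frac1n\log\beta_n^{\varepsilon,\delta}(\alpha)\ge-\varphi(\varepsilon,\delta)\,D_{\mathsf{KL}}(P_0\|P_1),$$ where $\varphi(\varepsilon,\delta)=1-(1-\delta)e^{-\varepsilon}$.
   Context: A Markov kernel $\mathsf{K}:\mathcal{X}\to\mathcal{P}(\mathcal{Z})$ (from $\mathcal{X}$ to probability measures on $\mathcal{Z}$) is $(\varepsilon,\delta)$-LDP if $\sup_{x_1,x_2\in\mathcal{X}}\sup_{A\subset\mathcal{Z}}[\mathsf{K}(A|x_1)-e^\varepsilon\mathsf{K}(A|x_2)]\le\delta$ ($A$ measurable); $\mathcal{Q}_{\varepsilon,\delta}$ is the family of all such kernels. Private binary hypothesis testing: $X_1,\dots,X_n$ are i.i.d. from $Q$, each $X_i$ is mapped independently to $Z_i$ by the same kernel $\mathsf{K}\in\mathcal{Q}_{\varepsilon,\delta}$, and from $Z^n=(Z_1,\dots,Z_n)$ one tests $H_0:Q=P_0$ against $H_1:Q=P_1$ via a randomized decision rule $P_{T|Z^n}$ with $T\in\{0,1\}$, where $T=1$ means $H_0$ is rejected. The optimal trade-off is $$\beta_n^{\varepsilon,\delta}(\alpha)=\inf_{\mathsf{K}\in\mathcal{Q}_{\varepsilon,\delta}}\ \inf_{P_{T|Z^n}:\ \Pr(T=1|H_0)\le\alpha}\Pr(T=0|H_1).$$ $D_{\mathsf{KL}}$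 is the Kullback-Leibler divergence and $\log$ is the natural logarithm.
   Formalization: The inequality is stated for the liminf; existence of the limit is asserted only when D_KL(P_0||P_1) is finite or δ=0, since for infinite divergence and δ>0 the limit can fail to exist (e.g. binary Z); there the right-hand side is −∞. *)

theory Defs
  imports "HOL-Probability.Probability"
begin

text \<open>
  Extended-real natural logarithm on \<open>[0, \<infinity>]\<close>, with \<open>log 0 = -\<infinity>\<close>;
  the value on negative arguments is irrelevant.
\<close>

definition ext_ln :: "ereal \<Rightarrow> ereal" where
  "ext_ln x = (if x \<le> 0 then -\<infinity> else if x = \<infinity> then \<infinity> else ereal (ln (real_of_ereal x)))"

text \<open>
  Kullback-Leibler divergence \<open>D(P \<parallel> Q)\<close> with values in the extended reals. The library's
  \<open>KL_divergence b Q P\<close> (note the argument order) is real-valued, hence meaningful only if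
  \<open>P \<lless> Q\<close> and the log-density is \<open>P\<close>-integrable. For probability measures with \<open>P \<lless> Q\<close> the
  negative part of the log-density is always \<open>P\<close>-integrable, so in the remaining cases the
  divergence is \<open>\<infinity>\<close>.
\<close>

definition ext_KL :: "'a measure \<Rightarrow> 'a measure \<Rightarrow> ereal" where
  "ext_KL P Q =
    (if absolutely_continuous Q P \<and> integrable P (entropy_density (exp 1) Q P)
     then ereal (KL_divergence (exp 1) Q P) else \<infinity>)"

definition LDP_kernels ::
    "'x measure \<Rightarrow> 'z measure \<Rightarrow> real \<Rightarrow> real \<Rightarrow> ('x \<Rightarrow> 'z measure) set" where
  "LDP_kernels X Z \<epsilon> \<delta> =
    {K \<in> X \<rightarrow>\<^sub>M prob_algebra Z.
      \<forall>x1\<in>space X. \<forall>x2\<in>space X. \<forall>A\<in>sets Z.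
        measure (K x1) A - exp \<epsilon> * measure (K x2) A \<le> \<delta>}"

text \<open>
  Law of \<open>Z\<^sup>n\<close> when \<open>X\<^sub>1, \<dots>, X\<^sub>n\<close> are i.i.d. from \<open>Q\<close> and, given \<open>X\<^sup>n\<close>, the \<open>Z\<^sub>i\<close> are
  independent with \<open>Z\<^sub>i\<close> distributed as \<open>K X\<^sub>i\<close>.
\<close>

definition private_law :: "nat \<Rightarrow> ('x \<Rightarrow> 'z measure) \<Rightarrow> 'x measure \<Rightarrow> (nat \<Rightarrow> 'z) measure" where
  "private_law n K Q =
    PiM {..<n} (\<lambda>_. Q) \<bind> (\<lambda>x. PiM {..<n} (\<lambda>i. K (x i)))"

definition decision_rules :: "nat \<Rightarrow> 'z measure \<Rightarrow> ((nat \<Rightarrow> 'z) \<Rightarrow> nat measure) set" where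
  "decision_rules n Z = PiM {..<n} (\<lambda>_. Z) \<rightarrow>\<^sub>M prob_algebra (count_space {0, 1})"

definition decision_prob ::
    "nat \<Rightarrow> ('x \<Rightarrow> 'z measure) \<Rightarrow> ((nat \<Rightarrow> 'z) \<Rightarrow> nat measure) \<Rightarrow> 'x measure \<Rightarrow> nat \<Rightarrow> real" where
  "decision_prob n K W Q t = measure (private_law n K Q \<bind> W) {t}"

definition opt_tradeoff ::
    "'x measure \<Rightarrow> 'z measure \<Rightarrow> 'x measure \<Rightarrow> 'x measure \<Rightarrow> real \<Rightarrow> real \<Rightarrow> nat \<Rightarrow> real \<Rightarrow> ereal" where
  "opt_tradeoff X Z P0 P1 \<epsilon> \<delta> n \<alpha> =
    (INF K\<in>LDP_kernels X Z \<epsilon> \<delta>.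
      INF W\<in>{W \<in> decision_rules n Z. decision_prob n K W P0 1 \<le> \<alpha>}.
        ereal (decision_prob n K W P1 0))"

text \<open>The value at \<open>n = 0\<close> (where \<open>1 / 0 = 0\<close>) plays no role in the limit.\<close>

definition error_rate ::
    "'x measure \<Rightarrow> 'z measure \<Rightarrow> 'x measure \<Rightarrow> 'x measure \<Rightarrow> real \<Rightarrow> real \<Rightarrow> real \<Rightarrow> nat \<Rightarrow> ereal" where
  "error_rate X Z P0 P1 \<epsilon> \<delta> \<alpha> n =
    ereal (1 / real n) * ext_ln (opt_tradeoff X Z P0 P1 \<epsilon> \<delta> n \<alpha>)"

definition contraction_coeff :: "real \<Rightarrow> real \<Rightarrow> real" where
  "contraction_coeff \<epsilon> \<delta> = 1 - (1 - \<delta>) * exp (- \<epsilon>)"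

end

theory Submission
  imports Defs
begin

text \<open>
  Let \<open>g\<close> be the density of \<open>P0 K\<close> with respect to \<open>P1 K\<close>. An \<open>(\<epsilon>, \<delta>)\<close>-private kernel moves any two
  points to within total variation \<open>\<phi>\<close>, so it contracts every hockey-stick divergence, and hence
  every integral of them against \<open>d\<gamma> / \<gamma>\<close>, by the factor \<open>\<phi>\<close>. Integrating over all \<open>\<gamma> > 0\<close> gives the
  Kullback-Leibler divergence; integrating over \<open>\<gamma> \<ge> b\<close> controls the upper tail of \<open>ln g\<close>, and as
  the tail of the source pair vanishes for \<open>b \<rightarrow> \<infinity>\<close>, the tails vanish uniformly over all kernels.

  The second moment of \<open>ln g\<close> truncated at level \<open>c\<close> is at most \<open>c\<^sup>2 + 2\<close>, again for every kernel, so
  Chebyshev's inequality yields Stein's lemma together with its strong converse uniformly in the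
  kernel. Therefore the error exponent converges to the supremum \<open>S\<close> over kernels and levels of the
  mean truncated log-likelihood ratio, and \<open>S \<le> \<phi> D(P0 \<parallel> P1)\<close>. If \<open>\<delta> = 0\<close>, then \<open>ln g \<le> \<epsilon>\<close> makes all
  this work without any assumption on \<open>P0\<close> and \<open>P1\<close>.
\<close>

section \<open>Product measures\<close>

lemma emeasure_PiM_PiE:
  assumes "finite I" "\<And>i. i \<in> I \<Longrightarrow> prob_space (M i)" "\<And>i. i \<in> I \<Longrightarrow> A i \<in> sets (M i)"
  shows "emeasure (PiM I M) (Pi\<^sub>E I A) = (\<Prod>i\<in>I. emeasure (M i) (A i))"
proof -
  have "prod_emb I M I (Pi\<^sub>E I A) = Pi\<^sub>E I A"
    using assms(3) by (intro prod_emb_PiE_same_index) (auto dest: sets.sets_into_space)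
  with emeasure_PiM_emb[of I M I A] assms show ?thesis by simp
qed

text \<open>For finite \<open>I\<close> the generator \<open>prod_algebra\<close> consists of the
  rectangles. The mass of a rectangle under the product kernel is a finite product of measurable
  functions of single coordinates.\<close>

lemma measurable_PiM_kernel:
  assumes K: "K \<in> M \<rightarrow>\<^sub>M prob_algebra N" and I: "finite I"
  shows "(\<lambda>x. PiM I (\<lambda>i. K (x i))) \<in> PiM I (\<lambda>_. M) \<rightarrow>\<^sub>M prob_algebra (PiM I (\<lambda>_. N))"
proof (rule measurable_prob_algebra_generated[OF sets_PiM Int_stable_prod_algebra prod_algebra_sets_into_space])
  fix x assume x: "x \<in> space (PiM I (\<lambda>_. M))"
  then have Kx: "K (x i) \<in> space (prob_algebra N)" if "i \<in> I" for i
    using that measurable_space[OF K, of "x i"] by (auto simp: space_PiM)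
  show "prob_space (PiM I (\<lambda>i. K (x i)))"
    by (rule prob_space_PiM) (use Kx in \<open>auto simp: space_prob_algebra\<close>)
  show "sets (PiM I (\<lambda>i. K (x i))) = sets (PiM I (\<lambda>_. N))"
    by (rule sets_PiM_cong) (use Kx in \<open>auto simp: space_prob_algebra\<close>)
next
  fix B assume "B \<in> prod_algebra I (\<lambda>_. N)"
  then obtain A where B: "B = Pi\<^sub>E I A" and A: "\<And>i. i \<in> I \<Longrightarrow> A i \<in> sets N"
    using I by (auto simp: prod_algebra_eq_finite)
  have meas: "(\<lambda>x. emeasure (K (x i)) (A i)) \<in> borel_measurable (PiM I (\<lambda>_. M))" if "i \<in> I" for i
    using measurable_compose[OF measurable_component_singleton[OF that]
        measurable_compose[OF measurable_prob_algebraD[OF K] measurable_emeasure_subprob_algebra[OF A[OF that]]]] .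
  have "emeasure (PiM I (\<lambda>i. K (x i))) B = (\<Prod>i\<in>I. emeasure (K (x i)) (A i))"
    if "x \<in> space (PiM I (\<lambda>_. M))" for x
  proof -
    have "K (x i) \<in> space (prob_algebra N)" if "i \<in> I" for i
      using that \<open>x \<in> _\<close> measurable_space[OF K, of "x i"] by (auto simp: space_PiM)
    then show ?thesis unfolding B
      by (intro emeasure_PiM_PiE[OF I]) (use A in \<open>auto simp: space_prob_algebra\<close>)
  qed
  then show "(\<lambda>x. emeasure (PiM I (\<lambda>i. K (x i))) B) \<in> borel_measurable (PiM I (\<lambda>_. M))"
    by (subst measurable_cong) (use meas in \<open>auto intro!: borel_measurable_prod_ennreal\<close>)
qed

text \<open>Privatising independent coordinates separately keeps them independent: on rectangles the
  integral of the product of coordinate kernels factorises. This reduces the private observations to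
  an i.i.d. sample from \<open>Q \<bind> K\<close>.\<close>

lemma PiM_bind_kernel:
  assumes Q: "Q \<in> space (prob_algebra M)" and K: "K \<in> M \<rightarrow>\<^sub>M prob_algebra N" and I: "finite I"
  shows "PiM I (\<lambda>_. Q) \<bind> (\<lambda>x. PiM I (\<lambda>i. K (x i))) = PiM I (\<lambda>_. Q \<bind> K)"
proof -
  have Q': "prob_space Q" "sets Q = sets M" using Q by (auto simp: space_prob_algebra)
  have QK: "prob_space (Q \<bind> K)" "sets (Q \<bind> K) = sets N"
    using prob_space_bind'[OF Q K] sets_bind'[OF Q K] .
  interpret Q: product_sigma_finite "\<lambda>_. Q"
    by (intro product_sigma_finite.intro prob_space_imp_sigma_finite) (rule Q'(1))
  interpret QK: product_sigma_finite "\<lambda>_. Q \<bind> K"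
    by (intro product_sigma_finite.intro prob_space_imp_sigma_finite) (rule QK(1))
  have PQ: "PiM I (\<lambda>_. Q) \<in> space (prob_algebra (PiM I (\<lambda>_. M)))"
    by (auto simp: space_prob_algebra Q' intro!: prob_space_PiM sets_PiM_cong)
  note KI = measurable_PiM_kernel[OF K I]
  show ?thesis
  proof (rule QK.PiM_eqI[OF I])
    show "sets (PiM I (\<lambda>_. Q) \<bind> (\<lambda>x. PiM I (\<lambda>i. K (x i)))) = sets (PiM I (\<lambda>_. Q \<bind> K))"
      unfolding sets_bind'[OF PQ KI] by (rule sets_PiM_cong) (simp_all add: QK)
    fix A :: "_ \<Rightarrow> _ set" assume "\<And>i. i \<in> I \<Longrightarrow> A i \<in> sets (Q \<bind> K)"
    then have A: "\<And>i. i \<in> I \<Longrightarrow> A i \<in> sets N" by (simp add: QK)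
    have "emeasure (PiM I (\<lambda>_. Q) \<bind> (\<lambda>x. PiM I (\<lambda>i. K (x i)))) (Pi\<^sub>E I A) =
      (\<integral>\<^sup>+x. emeasure (PiM I (\<lambda>i. K (x i))) (Pi\<^sub>E I A) \<partial>PiM I (\<lambda>_. Q))"
      by (rule emeasure_bind_prob_algebra[OF PQ KI sets_PiM_I_finite[OF I A]])
    also have "\<dots> = (\<integral>\<^sup>+x. (\<Prod>i\<in>I. emeasure (K (x i)) (A i)) \<partial>PiM I (\<lambda>_. Q))"
    proof (rule nn_integral_cong)
      fix x assume x: "x \<in> space (PiM I (\<lambda>_. Q))"
      have "x i \<in> space M" if "i \<in> I" for i
        using that x unfolding space_PiM sets_eq_imp_space_eq[OF Q'(2)] by (rule PiE_mem[rotated])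
      then have "K (x i) \<in> space (prob_algebra N)" if "i \<in> I" for i
        using that measurable_space[OF K] by blast
      then show "emeasure (PiM I (\<lambda>i. K (x i))) (Pi\<^sub>E I A) = (\<Prod>i\<in>I. emeasure (K (x i)) (A i))"
        by (intro emeasure_PiM_PiE[OF I]) (use A in \<open>auto simp: space_prob_algebra\<close>)
    qed
    also have "\<dots> = (\<Prod>i\<in>I. \<integral>\<^sup>+x. emeasure (K x) (A i) \<partial>Q)"
    proof (rule Q.product_nn_integral_prod[OF I])
      fix i assume "i \<in> I"
      from measurable_compose[OF measurable_prob_algebraD[OF K] measurable_emeasure_subprob_algebra[OF A[OF this]]]
      show "(\<lambda>x. emeasure (K x) (A i)) \<in> borel_measurable Q"
        using Q'(2) by (simp cong: measurable_cong_sets)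
    qed
    also have "\<dots> = (\<Prod>i\<in>I. emeasure (Q \<bind> K) (A i))"
      by (intro prod.cong refl emeasure_bind_prob_algebra[OF Q K, symmetric] A)
    finally show "emeasure (PiM I (\<lambda>_. Q) \<bind> (\<lambda>x. PiM I (\<lambda>i. K (x i)))) (Pi\<^sub>E I A) =
      (\<Prod>i\<in>I. emeasure (Q \<bind> K) (A i))" .
  qed
qed

text \<open>Checked on rectangles, where the indicator is itself a product over coordinates, so that
  the integral of density times indicator factorises. It yields the likelihood ratio of the whole
  sample as the product of the single ratios.\<close>

lemma PiM_density:
  fixes g :: "'a \<Rightarrow> ennreal"
  assumes "prob_space \<nu>" and [measurable]: "g \<in> borel_measurable \<nu>"
    and "prob_space (density \<nu> g)" and I: "finite I"
  shows "PiM I (\<lambda>_. density \<nu> g) = density (PiM I (\<lambda>_. \<nu>)) (\<lambda>z. \<Prod>i\<in>I. g (z i))"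
proof -
  interpret N: product_sigma_finite "\<lambda>_. \<nu>"
    by (intro product_sigma_finite.intro prob_space_imp_sigma_finite) (rule assms(1))
  interpret M: product_sigma_finite "\<lambda>_. density \<nu> g"
    by (intro product_sigma_finite.intro prob_space_imp_sigma_finite) (rule assms(3))
  have [measurable]: "(\<lambda>z. \<Prod>i\<in>I. g (z i)) \<in> borel_measurable (PiM I (\<lambda>_. \<nu>))"
    by (intro borel_measurable_prod_ennreal) measurable
  show ?thesis
  proof (rule M.PiM_eqI[OF I, symmetric])
    show "sets (density (PiM I (\<lambda>_. \<nu>)) (\<lambda>z. \<Prod>i\<in>I. g (z i))) = sets (PiM I (\<lambda>_. density \<nu> g))"
      by (simp, rule sets_PiM_cong) auto
    fix A :: "_ \<Rightarrow> _ set" assume "\<And>i. i \<in> I \<Longrightarrow> A i \<in> sets (density \<nu> g)"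
    then have A[measurable]: "\<And>i. i \<in> I \<Longrightarrow> A i \<in> sets \<nu>" by simp
    have "emeasure (density (PiM I (\<lambda>_. \<nu>)) (\<lambda>z. \<Prod>i\<in>I. g (z i))) (Pi\<^sub>E I A)
      = (\<integral>\<^sup>+z. (\<Prod>i\<in>I. g (z i)) * indicator (Pi\<^sub>E I A) z \<partial>PiM I (\<lambda>_. \<nu>))"
      by (rule emeasure_density[OF _ sets_PiM_I_finite[OF I A]]) simp
    also have "\<dots> = (\<integral>\<^sup>+z. (\<Prod>i\<in>I. g (z i) * indicator (A i) (z i)) \<partial>PiM I (\<lambda>_. \<nu>))"
    proof (rule nn_integral_cong)
      fix z assume z: "z \<in> space (PiM I (\<lambda>_. \<nu>))"
      have "(indicator (Pi\<^sub>E I A) z :: ennreal) = (\<Prod>i\<in>I. indicator (A i) (z i))"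
      proof (cases "z \<in> Pi\<^sub>E I A")
        case False
        then obtain i where "i \<in> I" "z i \<notin> A i" using z by (auto simp: space_PiM PiE_iff)
        then have "(\<Prod>i\<in>I. indicator (A i) (z i)) = (0 :: ennreal)"
          using I by (auto intro!: prod_zero bexI[of _ i])
        with False show ?thesis by simp
      qed (auto simp: PiE_iff intro!: prod.neutral[symmetric])
      then show "(\<Prod>i\<in>I. g (z i)) * indicator (Pi\<^sub>E I A) z = (\<Prod>i\<in>I. g (z i) * indicator (A i) (z i))"
        by (simp add: prod.distrib)
    qed
    also have "\<dots> = (\<Prod>i\<in>I. \<integral>\<^sup>+x. g x * indicator (A i) x \<partial>\<nu>)"
      by (rule N.product_nn_integral_prod[OF I]) (use A in measurable)
    also have "\<dots> = (\<Prod>i\<in>I. emeasure (density \<nu> g) (A i))"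
      by (intro prod.cong refl) (simp add: A emeasure_density)
    finally show "emeasure (density (PiM I (\<lambda>_. \<nu>)) (\<lambda>z. \<Prod>i\<in>I. g (z i))) (Pi\<^sub>E I A) =
      (\<Prod>i\<in>I. emeasure (density \<nu> g) (A i))" .
  qed
qed

lemma integral_PiM_component:
  fixes h :: "'a \<Rightarrow> real"
  assumes "prob_space M" "i \<in> I" and [measurable]: "h \<in> borel_measurable M"
  shows "(\<integral>z. h (z i) \<partial>PiM I (\<lambda>_. M)) = (\<integral>x. h x \<partial>M)"
    and "integrable (PiM I (\<lambda>_. M)) (\<lambda>z. h (z i)) \<longleftrightarrow> integrable M h"
proof -
  have c: "(\<lambda>z. z i) \<in> PiM I (\<lambda>_. M) \<rightarrow>\<^sub>M M" using assms(2) by measurable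
  have d: "distr (PiM I (\<lambda>_. M)) M (\<lambda>z. z i) = M"
    by (rule distr_PiM_component[where M = "\<lambda>_. M", OF assms(1,2)])
  show "(\<integral>z. h (z i) \<partial>PiM I (\<lambda>_. M)) = (\<integral>x. h x \<partial>M)"
    using integral_distr[OF c, of h] d by simp
  show "integrable (PiM I (\<lambda>_. M)) (\<lambda>z. h (z i)) \<longleftrightarrow> integrable M h"
    using integrable_distr_eq[OF c, of h] d by simp
qed

text \<open>Chebyshev's inequality with an explicit rate. The rate depends on \<open>M\<close> and
  \<open>h\<close> only through the second-moment bound \<open>V\<close>, so one \<open>V\<close>
  valid for all kernels gives a deviation bound uniform in the kernel.\<close>

lemma weak_law_PiM:
  fixes h :: "'a \<Rightarrow> real"
  assumes M: "prob_space M" and [measurable]: "h \<in> borel_measurable M"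
    and sq: "integrable M (\<lambda>x. (h x)\<^sup>2)" and V: "(\<integral>x. (h x)\<^sup>2 \<partial>M) \<le> V"
    and "0 < \<eta>" "0 < n"
  shows "measure (PiM {..<n} (\<lambda>_. M))
      {z \<in> space (PiM {..<n} (\<lambda>_. M)). real n * \<eta> \<le> \<bar>(\<Sum>i<n. h (z i)) - real n * (\<integral>x. h x \<partial>M)\<bar>}
    \<le> V / (real n * \<eta>\<^sup>2)"
proof -
  let ?P = "PiM {..<n} (\<lambda>_. M)"
  interpret M: prob_space M by fact
  interpret P: product_sigma_finite "\<lambda>_. M"
    by (intro product_sigma_finite.intro prob_space_imp_sigma_finite M)
  interpret PP: prob_space ?P by (rule prob_space_PiM) (rule M)
  have ih: "integrable M h" by (rule M.square_integrable_imp_integrable) (use sq in auto)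
  define m where "m = (\<integral>x. h x \<partial>M)"
  define k where "k x = h x - m" for x
  have [measurable]: "k \<in> borel_measurable M" unfolding k_def by measurable
  have ik: "integrable M k" and mk: "(\<integral>x. k x \<partial>M) = 0"
    using ih by (auto simp: k_def[abs_def] m_def M.prob_space)
  have ik2: "integrable M (\<lambda>x. (k x)\<^sup>2)"
    unfolding k_def power2_diff using sq ih by auto
  have vk: "(\<integral>x. (k x)\<^sup>2 \<partial>M) \<le> V"
    using M.variance_eq[OF ih sq] V zero_le_power2[of m] unfolding k_def m_def by linarith
  have cross: "integrable ?P (\<lambda>z. k (z i) * k (z j)) \<and>
      (\<integral>z. k (z i) * k (z j) \<partial>?P) = (if i = j then \<integral>x. (k x)\<^sup>2 \<partial>M else 0)"
    if "i < n" "j < n" for i j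
  proof (cases "i = j")
    case True
    with that integral_PiM_component[OF M, of j "{..<n}" "\<lambda>x. (k x)\<^sup>2"] ik2 show ?thesis
      by (simp add: power2_eq_square)
  next
    case False
    \<comment> \<open>The product of two coordinates is written as a product over all coordinates
      with constant factors \<open>1\<close> elsewhere, so that the product integral formula
      applies. It vanishes because the factor at \<open>i\<close> is centred.\<close>
    define f where "f l = (if l = i \<or> l = j then k else (\<lambda>_. 1))" for l
    have f: "integrable M (f l)" for l by (simp add: f_def ik)
    have eq: "(\<Prod>l<n. f l (z l)) = k (z i) * k (z j)" for z
    proof -
      have "(\<Prod>l<n. f l (z l)) = (\<Prod>l\<in>{i, j}. f l (z l))"
        by (rule prod.mono_neutral_right) (use that in \<open>auto simp: f_def\<close>)
      then show ?thesis using False by (simp add: f_def)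
    qed
    have "integrable ?P (\<lambda>z. k (z i) * k (z j))"
      using P.product_integrable_prod[of "{..<n}" f] f by (simp add: eq)
    moreover have "(\<integral>z. k (z i) * k (z j) \<partial>?P) = (\<Prod>l<n. \<integral>x. f l x \<partial>M)"
      using P.product_integral_prod[of "{..<n}" f] f by (simp add: eq)
    moreover have "\<dots> = 0" by (rule prod_zero) (use that mk in \<open>auto simp: f_def\<close>)
    ultimately show ?thesis using False by simp
  qed
  define Y where "Y z = (\<Sum>i<n. k (z i))" for z
  have Ysq: "(Y z)\<^sup>2 = (\<Sum>i<n. \<Sum>j<n. k (z i) * k (z j))" for z
    by (simp add: Y_def power2_eq_square sum_product)
  have iY2: "integrable ?P (\<lambda>z. (Y z)\<^sup>2)"
    unfolding Ysq by (intro Bochner_Integration.integrable_sum) (use cross in auto)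
  have [measurable]: "Y \<in> borel_measurable ?P"
    unfolding Y_def by (intro borel_measurable_sum) measurable
  have "(\<integral>z. (Y z)\<^sup>2 \<partial>?P) = (\<Sum>i<n. \<Sum>j<n. \<integral>z. k (z i) * k (z j) \<partial>?P)"
    unfolding Ysq
    by (subst Bochner_Integration.integral_sum) (use cross in \<open>auto intro!: sum.cong\<close>)
  also have "\<dots> = (\<Sum>i<n. \<Sum>j<n. if i = j then \<integral>x. (k x)\<^sup>2 \<partial>M else 0)"
    by (intro sum.cong refl) (use cross in auto)
  also have "\<dots> = real n * (\<integral>x. (k x)\<^sup>2 \<partial>M)" by simp
  also have "\<dots> \<le> real n * V" using vk by (intro mult_left_mono) auto
  finally have EY2: "(\<integral>z. (Y z)\<^sup>2 \<partial>?P) \<le> real n * V" .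
  have "{z \<in> space ?P. real n * \<eta> \<le> \<bar>(\<Sum>i<n. h (z i)) - real n * m\<bar>}
      = {z \<in> space ?P. (real n * \<eta>)\<^sup>2 \<le> (Y z)\<^sup>2}"
    using \<open>0 < \<eta>\<close> abs_le_square_iff[of "real n * \<eta>"] by (auto simp: Y_def k_def sum_subtractf)
  then have "measure ?P {z \<in> space ?P. real n * \<eta> \<le> \<bar>(\<Sum>i<n. h (z i)) - real n * m\<bar>}
      \<le> (\<integral>z. (Y z)\<^sup>2 \<partial>?P) / (real n * \<eta>)\<^sup>2"
    using integral_Markov_inequality_measure[OF iY2, of "{}" "(real n * \<eta>)\<^sup>2"] assms by simp
  also have "\<dots> \<le> real n * V / (real n * \<eta>)\<^sup>2"
    using EY2 by (intro divide_right_mono) auto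
  also have "\<dots> = V / (real n * \<eta>\<^sup>2)" using assms by (simp add: power2_eq_square)
  finally show ?thesis by (simp add: m_def)
qed

section \<open>Stein's lemma for a pair of measures\<close>

text \<open>For \<open>u \<ge> 1\<close> the truncated logarithm lies in the interval from
  \<open>0\<close> to \<open>c\<close>. For \<open>0 < u < 1\<close> the weight \<open>u\<close>
  tames the square, since \<open>(ln u)\<^sup>2 / 2 \<le> exp (- ln u) = 1 / u\<close>. Integrated
  against a law under which \<open>u\<close> has mean 1, the right side becomes
  \<open>c\<^sup>2 + 2\<close>, whatever that law is.\<close>

lemma likelihood_ln_sq_bound:
  fixes u c :: real
  assumes "0 \<le> u" "0 \<le> c"
  shows "u * (min (ln u) c)\<^sup>2 \<le> c\<^sup>2 * u + 2"
proof (cases "u < 1")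
  case False
  then have "0 \<le> min (ln u) c" using assms by simp
  then have "(min (ln u) c)\<^sup>2 \<le> c\<^sup>2" by (intro power_mono) auto
  with assms have "u * (min (ln u) c)\<^sup>2 \<le> u * c\<^sup>2" by (intro mult_left_mono)
  then show ?thesis by (simp add: mult.commute)
next
  case True
  show ?thesis
  proof (cases "u = 0")
    case False
    with assms True have u: "0 < u" "ln u \<le> 0" by auto
    have "(ln u)\<^sup>2 / 2 \<le> exp (- ln u)"
    proof -
      have "1 + (- ln u) + (- ln u)\<^sup>2 / 2 \<le> exp (- ln u)"
        using u(2) by (intro exp_lower_Taylor_quadratic) linarith
      with u(2) show ?thesis unfolding power2_minus by linarith
    qed
    then have "(ln u)\<^sup>2 / 2 \<le> 1 / u" using u by (simp add: exp_minus inverse_eq_divide)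
    then have "u * (ln u)\<^sup>2 \<le> 2" using u by (simp add: field_simps)
    moreover have "min (ln u) c = ln u" using u(2) assms by linarith
    ultimately show ?thesis using assms by (simp add: add_increasing)
  qed simp
qed

text \<open>\<open>\<mu>\<close> plays the null hypothesis and \<open>\<nu>\<close> the alternative,
  with \<open>g\<close> their likelihood ratio. The locale is instantiated both at the source pair
  \<open>P0\<close>, \<open>P1\<close> and at the pair of channel outputs. A real-valued
  \<open>g\<close> allows Bochner integrals throughout.\<close>

locale likelihood_pair = M: prob_space \<mu> + N: prob_space \<nu>
  for \<mu> \<nu> :: "'z measure" +
  fixes g :: "'z \<Rightarrow> real"
  assumes g_measurable[measurable]: "g \<in> borel_measurable \<nu>"
    and g_nonneg: "\<And>z. 0 \<le> g z"
    and density: "\<mu> = density \<nu> (\<lambda>z. ennreal (g z))"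
begin

lemma sets_eq: "sets \<mu> = sets \<nu>"
  by (simp add: density)

lemma g_measurable'[measurable]: "g \<in> borel_measurable \<mu>"
  by (simp add: density)

lemma nn_integral_g: "(\<integral>\<^sup>+z. ennreal (g z) \<partial>\<nu>) = 1"
  using M.emeasure_space_1 by (simp add: density emeasure_density cong: nn_integral_cong)

lemma integrable_g: "integrable \<nu> g" and integral_g: "(\<integral>z. g z \<partial>\<nu>) = 1"
proof -
  show "integrable \<nu> g"
    by (rule integrableI_nn_integral_finite[where x = 1]) (simp_all add: g_nonneg nn_integral_g)
  show "(\<integral>z. g z \<partial>\<nu>) = 1"
    by (rule integral_eq_nn_integral[THEN trans]) (simp_all add: g_nonneg nn_integral_g)
qed

lemma AE_g_pos: "AE z in \<mu>. 0 < g z"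
  unfolding density by (subst AE_density) auto

text \<open>Truncation is from above only: the lower tail of \<open>ln g\<close> is square
  integrable under \<open>\<mu>\<close> because of the weight \<open>g\<close>. Points with
  \<open>g z = 0\<close>, where \<open>ln\<close> has the default value \<open>0\<close>, form a
  \<open>\<mu>\<close>-null set.\<close>

definition trunc_llr :: "real \<Rightarrow> 'z \<Rightarrow> real" where
  "trunc_llr c z = min (ln (g z)) c"

lemma trunc_llr_measurable[measurable]:
  "trunc_llr c \<in> borel_measurable \<nu>" "trunc_llr c \<in> borel_measurable \<mu>"
  unfolding trunc_llr_def by measurable

lemma trunc_llr_square:
  assumes "0 \<le> c"
  shows "integrable \<mu> (\<lambda>z. (trunc_llr c z)\<^sup>2)" and "(\<integral>z. (trunc_llr c z)\<^sup>2 \<partial>\<mu>) \<le> c\<^sup>2 + 2"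
proof -
  have b: "g z * (trunc_llr c z)\<^sup>2 \<le> c\<^sup>2 * g z + 2" for z
    unfolding trunc_llr_def by (rule likelihood_ln_sq_bound[OF g_nonneg assms])
  have ib: "integrable \<nu> (\<lambda>z. c\<^sup>2 * g z + 2)" using integrable_g by simp
  have i: "integrable \<nu> (\<lambda>z. g z * (trunc_llr c z)\<^sup>2)"
    by (rule Bochner_Integration.integrable_bound[OF ib]) (use b in \<open>auto simp: g_nonneg\<close>)
  show "integrable \<mu> (\<lambda>z. (trunc_llr c z)\<^sup>2)"
    unfolding density by (subst integrable_density) (use i in \<open>auto simp: g_nonneg\<close>)
  have "(\<integral>z. (trunc_llr c z)\<^sup>2 \<partial>\<mu>) = (\<integral>z. g z * (trunc_llr c z)\<^sup>2 \<partial>\<nu>)"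
    unfolding density by (subst integral_density) (auto simp: g_nonneg)
  also have "\<dots> \<le> (\<integral>z. c\<^sup>2 * g z + 2 \<partial>\<nu>)" by (rule integral_mono[OF i ib b])
  also have "\<dots> = c\<^sup>2 + 2" using integrable_g by (simp add: integral_g N.prob_space)
  finally show "(\<integral>z. (trunc_llr c z)\<^sup>2 \<partial>\<mu>) \<le> c\<^sup>2 + 2" .
qed

lemma trunc_llr_integrable: "0 \<le> c \<Longrightarrow> integrable \<mu> (trunc_llr c)"
  by (rule M.square_integrable_imp_integrable) (use trunc_llr_square(1) in auto)

definition Mn :: "nat \<Rightarrow> (nat \<Rightarrow> 'z) measure" where "Mn n = PiM {..<n} (\<lambda>_. \<mu>)"
definition Nn :: "nat \<Rightarrow> (nat \<Rightarrow> 'z) measure" where "Nn n = PiM {..<n} (\<lambda>_. \<nu>)"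

lemma prob_space_Mn: "prob_space (Mn n)"
  unfolding Mn_def by (rule prob_space_PiM) (rule M.prob_space_axioms)

lemma prob_space_Nn: "prob_space (Nn n)"
  unfolding Nn_def by (rule prob_space_PiM) (rule N.prob_space_axioms)

lemma sets_Mn: "sets (Mn n) = sets (Nn n)"
  unfolding Mn_def Nn_def by (rule sets_PiM_cong) (simp_all add: sets_eq)

lemma gn_measurable[measurable]: "(\<lambda>z. \<Prod>i<n. g (z i)) \<in> borel_measurable (Nn n)"
  unfolding Nn_def by (intro borel_measurable_prod) measurable

lemma gn_measurable'[measurable]: "(\<lambda>z. \<Prod>i<n. g (z i)) \<in> borel_measurable (Mn n)"
  using gn_measurable[of n] by (simp cong: measurable_cong_sets add: sets_Mn)

lemma Mn_density: "Mn n = density (Nn n) (\<lambda>z. ennreal (\<Prod>i<n. g (z i)))"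
proof -
  have "prob_space (density \<nu> (\<lambda>z. ennreal (g z)))"
    using M.prob_space_axioms by (simp add: density)
  from PiM_density[OF N.prob_space_axioms _ this, of "{..<n}"] show ?thesis
    by (simp add: Mn_def Nn_def density[symmetric] prod_ennreal g_nonneg)
qed

lemma trunc_llr_deviation:
  assumes "0 \<le> c" "0 < \<eta>" "0 < n"
  shows "measure (Mn n) {z \<in> space (Mn n).
      real n * \<eta> \<le> \<bar>(\<Sum>i<n. trunc_llr c (z i)) - real n * (\<integral>z. trunc_llr c z \<partial>\<mu>)\<bar>}
    \<le> (c\<^sup>2 + 2) / (real n * \<eta>\<^sup>2)"
  unfolding Mn_def
  by (rule weak_law_PiM[OF M.prob_space_axioms _ trunc_llr_square])
     (use assms in simp_all)

text \<open>The excess over the level \<open>c\<close> has only a controlled first moment, so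
  Markov's inequality replaces Chebyshev's. The bound does not decay with \<open>n\<close>; it
  becomes small through the choice of \<open>c\<close>, which makes \<open>r\<close> small.\<close>

lemma excess_deviation:
  assumes e: "integrable \<mu> (\<lambda>z. max 0 (ln (g z) - c))" "(\<integral>z. max 0 (ln (g z) - c) \<partial>\<mu>) \<le> r"
    and "0 < \<eta>" "0 < n"
  shows "measure (Mn n) {z \<in> space (Mn n). real n * \<eta> \<le> (\<Sum>i<n. max 0 (ln (g (z i)) - c))} \<le> r / \<eta>"
proof -
  have c: "integrable (Mn n) (\<lambda>z. max 0 (ln (g (z i)) - c))"
    "(\<integral>z. max 0 (ln (g (z i)) - c) \<partial>Mn n) = (\<integral>z. max 0 (ln (g z) - c) \<partial>\<mu>)" if "i < n" for i
    using integral_PiM_component[OF M.prob_space_axioms, of i "{..<n}" "\<lambda>z. max 0 (ln (g z) - c)"] e(1) that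
    by (auto simp: Mn_def)
  have i: "integrable (Mn n) (\<lambda>z. \<Sum>i<n. max 0 (ln (g (z i)) - c))"
    by (intro Bochner_Integration.integrable_sum) (use c in auto)
  have "(\<integral>z. (\<Sum>i<n. max 0 (ln (g (z i)) - c)) \<partial>Mn n) = real n * (\<integral>z. max 0 (ln (g z) - c) \<partial>\<mu>)"
    by (subst Bochner_Integration.integral_sum) (use c in auto)
  also have "\<dots> \<le> real n * r" using e(2) by (intro mult_left_mono) auto
  finally have "(\<integral>z. (\<Sum>i<n. max 0 (ln (g (z i)) - c)) \<partial>Mn n) / (real n * \<eta>) \<le> real n * r / (real n * \<eta>)"
    using assms by (intro divide_right_mono) auto
  with integral_Markov_inequality_measure[OF i, of "{}" "real n * \<eta>"] assms
  show ?thesis by (simp add: sum_nonneg)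
qed

text \<open>Change of measure: where the likelihood ratio is at most
  \<open>exp (real n * (S + 2 * \<eta>))\<close>, mass under \<open>Mn\<close> costs at most that
  factor times mass under \<open>Nn\<close>. The complement has small \<open>Mn\<close> probability,
  with a bound that involves only \<open>c\<close>, \<open>r\<close>, \<open>\<eta>\<close> and
  \<open>n\<close>. The function \<open>w\<close> stands for the acceptance probability of a
  randomised test.\<close>

lemma strong_converse:
  assumes c: "0 \<le> c" and S: "(\<integral>z. trunc_llr c z \<partial>\<mu>) \<le> S"
    and e: "integrable \<mu> (\<lambda>z. max 0 (ln (g z) - c))" "(\<integral>z. max 0 (ln (g z) - c) \<partial>\<mu>) \<le> r"
    and "0 < \<eta>" "0 < n"
    and w[measurable]: "w \<in> borel_measurable (Nn n)" and w01: "\<And>z. z \<in> space (Nn n) \<Longrightarrow> 0 \<le> w z \<and> w z \<le> 1"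
  shows "(\<integral>z. w z \<partial>Mn n) \<le> exp (real n * (S + 2 * \<eta>)) * (\<integral>z. w z \<partial>Nn n) + ((c\<^sup>2 + 2) / (real n * \<eta>\<^sup>2) + r / \<eta>)"
proof -
  interpret Mn: prob_space "Mn n" by (rule prob_space_Mn)
  interpret Nn: prob_space "Nn n" by (rule prob_space_Nn)
  have sp: "space (Mn n) = space (Nn n)" by (rule sets_eq_imp_space_eq[OF sets_Mn])
  have w'[measurable]: "w \<in> borel_measurable (Mn n)" using w by (simp cong: measurable_cong_sets add: sets_Mn)
  define G where "G z = (\<Prod>i<n. g (z i))" for z
  define E where "E = exp (real n * (S + 2 * \<eta>))"
  have [measurable]: "G \<in> borel_measurable (Nn n)" "G \<in> borel_measurable (Mn n)" unfolding G_def by measurable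
  have G0: "0 \<le> G z" for z unfolding G_def by (intro prod_nonneg) (simp add: g_nonneg)
  let ?B = "{z \<in> space (Mn n). E < G z}"
  let ?A1 = "{z \<in> space (Mn n).
      real n * \<eta> \<le> \<bar>(\<Sum>i<n. trunc_llr c (z i)) - real n * (\<integral>z. trunc_llr c z \<partial>\<mu>)\<bar>}"
  let ?A2 = "{z \<in> space (Mn n). real n * \<eta> \<le> (\<Sum>i<n. max 0 (ln (g (z i)) - c))}"
  \<comment> \<open>The log-likelihood ratio is the truncated sum plus the excess sum. To exceed
    \<open>real n * (S + 2 * \<eta>)\<close> one of them must use up \<open>real n * \<eta>\<close>,
    which explains the factor 2.\<close>
  have "?B \<subseteq> ?A1 \<union> ?A2"
  proof safe
    fix z assume z: "z \<in> space (Mn n)" "E < G z" and n2: "\<not> real n * \<eta> \<le> (\<Sum>i<n. max 0 (ln (g (z i)) - c))"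
    \<comment> \<open>A nonzero product has no zero factor, so \<open>ln_prod\<close> applies and no
      default value of \<open>ln\<close> enters.\<close>
    have "G z \<noteq> 0" using z(2) unfolding E_def by (metis exp_gt_zero less_asym)
    then have pos: "0 < g (z i)" if "i < n" for i
      using that g_nonneg[of "z i"] unfolding G_def by (auto simp: less_le prod_zero_iff)
    have "real n * (S + 2 * \<eta>) < ln (G z)"
      using z(2) G0[of z] \<open>G z \<noteq> 0\<close> unfolding E_def by (metis exp_less_cancel_iff exp_ln order_le_less)
    also have "ln (G z) = (\<Sum>i<n. ln (g (z i)))" unfolding G_def
      by (rule ln_prod) (use pos in force)+
    also have "\<dots> = (\<Sum>i<n. trunc_llr c (z i)) + (\<Sum>i<n. max 0 (ln (g (z i)) - c))"
      unfolding sum.distrib[symmetric] by (intro sum.cong) (auto simp: trunc_llr_def)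
    finally have "real n * (S + \<eta>) < (\<Sum>i<n. trunc_llr c (z i))"
      using n2 by (simp add: algebra_simps)
    moreover have "real n * (\<integral>z. trunc_llr c z \<partial>\<mu>) \<le> real n * S" using S by (intro mult_left_mono) auto
    ultimately show "real n * \<eta> \<le> \<bar>(\<Sum>i<n. trunc_llr c (z i)) - real n * (\<integral>z. trunc_llr c z \<partial>\<mu>)\<bar>"
      by (simp add: algebra_simps)
  qed
  moreover have A12[measurable]: "?A1 \<in> sets (Mn n)" "?A2 \<in> sets (Mn n)" unfolding Mn_def by measurable
  ultimately have "measure (Mn n) ?B \<le> measure (Mn n) (?A1 \<union> ?A2)"
    by (intro Mn.finite_measure_mono) auto
  also have "\<dots> \<le> measure (Mn n) ?A1 + measure (Mn n) ?A2"
    by (rule measure_Un_le[OF A12])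
  finally have B: "measure (Mn n) ?B \<le> (c\<^sup>2 + 2) / (real n * \<eta>\<^sup>2) + r / \<eta>"
    using trunc_llr_deviation[of c \<eta> n] excess_deviation[of c r \<eta> n] assms by simp
  define L where "L = {z \<in> space (Mn n). G z \<le> E}"
  define H where "H = ?B"
  have [measurable]: "L \<in> sets (Mn n)" "L \<in> sets (Nn n)" "H \<in> sets (Mn n)"
    by (simp_all add: L_def H_def sets_Mn[symmetric])
  have iw: "integrable (Nn n) w"
    by (rule Nn.integrable_const_bound[of _ 1]) (use w01 in \<open>auto intro!: AE_I2\<close>)
  have iw': "integrable (Mn n) w"
    by (rule Mn.integrable_const_bound[of _ 1]) (use w01 in \<open>auto simp: sp intro!: AE_I2\<close>)
  have iL: "integrable (Mn n) (\<lambda>z. w z * indicator L z)"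
    using integrable_mult_indicator[OF _ iw', of L] by (simp add: mult.commute)
  have iH: "integrable (Mn n) (indicator H :: _ \<Rightarrow> real)"
    by (simp add: Mn.emeasure_finite less_top[symmetric])
  have iGw: "integrable (Nn n) (\<lambda>z. G z * (w z * indicator L z))"
    using iL unfolding Mn_density G_def[symmetric]
    by (subst (asm) integrable_density) (auto simp: G0)
  \<comment> \<open>On \<open>H\<close> the test function is bounded by 1 and costs the small
    probability of \<open>H\<close>; on \<open>L\<close> the density of \<open>Mn\<close> is at most
    \<open>E\<close>.\<close>
  have "(\<integral>z. w z \<partial>Mn n) \<le> (\<integral>z. w z * indicator L z + indicator H z \<partial>Mn n)"
  proof (rule integral_mono[OF iw'])
    show "integrable (Mn n) (\<lambda>z. w z * indicator L z + indicator H z)" using iL iH by simp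
    show "w z \<le> w z * indicator L z + indicator H z" if "z \<in> space (Mn n)" for z
      using w01[of z] that by (auto simp: sp L_def H_def indicator_def)
  qed
  also have "\<dots> = (\<integral>z. w z * indicator L z \<partial>Mn n) + measure (Mn n) H"
    using iL iH by simp
  also have "(\<integral>z. w z * indicator L z \<partial>Mn n) = (\<integral>z. G z * (w z * indicator L z) \<partial>Nn n)"
    unfolding Mn_density G_def[symmetric] by (subst integral_density) (auto simp: G0)
  also have "\<dots> \<le> (\<integral>z. E * w z \<partial>Nn n)"
  proof (rule integral_mono[OF iGw])
    show "integrable (Nn n) (\<lambda>z. E * w z)" using iw by simp
    show "G z * (w z * indicator L z) \<le> E * w z" if "z \<in> space (Nn n)" for z
      using w01[OF that] G0[of z] by (auto simp: L_def indicator_def E_def intro!: mult_right_mono)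
  qed
  also have "\<dots> = E * (\<integral>z. w z \<partial>Nn n)" by simp
  finally show ?thesis using B by (simp add: E_def H_def)
qed

text \<open>The likelihood ratio test with threshold \<open>exp (real n * r)\<close>. Its mass under
  \<open>Nn\<close> is bounded by Markov's inequality, the ratio having mean 1. Since truncation
  only lowers the log-likelihood sum, rejection under \<open>Mn\<close> forces the truncated sum to
  fall short of its mean by \<open>m - r\<close> per sample.\<close>

lemma achievability:
  assumes c: "0 \<le> c" and r: "r < (\<integral>z. trunc_llr c z \<partial>\<mu>)" and "0 < n"
  defines "A \<equiv> {z \<in> space (Nn n). exp (real n * r) \<le> (\<Prod>i<n. g (z i))}"
  shows "measure (Nn n) A \<le> exp (- (real n * r))"
    and "1 - measure (Mn n) A \<le> (c\<^sup>2 + 2) / (real n * ((\<integral>z. trunc_llr c z \<partial>\<mu>) - r)\<^sup>2)"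
proof -
  interpret Mn: prob_space "Mn n" by (rule prob_space_Mn)
  interpret Nn: prob_space "Nn n" by (rule prob_space_Nn)
  have sp: "space (Mn n) = space (Nn n)" by (rule sets_eq_imp_space_eq[OF sets_Mn])
  define G where "G z = (\<Prod>i<n. g (z i))" for z
  have [measurable]: "G \<in> borel_measurable (Nn n)" "G \<in> borel_measurable (Mn n)" unfolding G_def by measurable
  have G0: "0 \<le> G z" for z unfolding G_def by (intro prod_nonneg) (simp add: g_nonneg)
  have nG: "(\<integral>\<^sup>+z. ennreal (G z) \<partial>Nn n) = 1"
    using Mn.emeasure_space_1 unfolding Mn_density G_def[symmetric]
    by (simp add: emeasure_density cong: nn_integral_cong)
  have iG: "integrable (Nn n) G"
    by (rule integrableI_nn_integral_finite[where x = 1]) (simp_all add: G0 nG)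
  have "(\<integral>z. G z \<partial>Nn n) = 1"
    by (rule integral_eq_nn_integral[THEN trans]) (simp_all add: G0 nG)
  with integral_Markov_inequality_measure[OF iG, of "{}" "exp (real n * r)"]
  show "measure (Nn n) A \<le> exp (- (real n * r))"
    by (simp add: A_def G_def[symmetric] G0 exp_minus inverse_eq_divide)
  have AM[measurable]: "A \<in> sets (Mn n)" unfolding A_def G_def[symmetric] sets_Mn by measurable
  define m where "m = (\<integral>z. trunc_llr c z \<partial>\<mu>)"
  let ?A1 = "{z \<in> space (Mn n). real n * (m - r) \<le> \<bar>(\<Sum>i<n. trunc_llr c (z i)) - real n * m\<bar>}"
  have pos: "AE z in Mn n. \<forall>i\<in>{..<n}. 0 < g (z i)"
    unfolding Mn_def
    by (intro eventually_ball_finite ballI AE_PiM_component AE_g_pos M.prob_space_axioms) auto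
  have "1 - measure (Mn n) A = measure (Mn n) (space (Mn n) - A)"
    using Mn.prob_compl[OF AM] by simp
  also have "\<dots> \<le> measure (Mn n) ?A1"
  proof (rule Mn.finite_measure_mono_AE)
    show "?A1 \<in> sets (Mn n)" unfolding Mn_def by measurable
    show "AE z in Mn n. z \<in> space (Mn n) - A \<longrightarrow> z \<in> ?A1"
      using pos
    proof eventually_elim
      case (elim z)
      show ?case
      proof
        assume z: "z \<in> space (Mn n) - A"
        then have "G z < exp (real n * r)" by (auto simp: A_def sp G_def)
        moreover have "0 < G z" unfolding G_def using elim by (intro prod_pos) auto
        ultimately have "ln (G z) < real n * r" by (metis exp_ln exp_less_cancel_iff)
        moreover have "ln (G z) = (\<Sum>i<n. ln (g (z i)))" unfolding G_def
          by (rule ln_prod) (use elim in force)+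
        moreover have "(\<Sum>i<n. trunc_llr c (z i)) \<le> (\<Sum>i<n. ln (g (z i)))"
          by (intro sum_mono) (simp add: trunc_llr_def)
        ultimately show "z \<in> ?A1" using z by (auto simp: algebra_simps)
      qed
    qed
  qed
  also have "\<dots> \<le> (c\<^sup>2 + 2) / (real n * (m - r)\<^sup>2)"
    using trunc_llr_deviation[of c "m - r" n] assms by (simp add: m_def)
  finally show "1 - measure (Mn n) A \<le> (c\<^sup>2 + 2) / (real n * ((\<integral>z. trunc_llr c z \<partial>\<mu>) - r)\<^sup>2)"
    by (simp add: m_def)
qed

end

section \<open>Hockey-stick representation of the divergence\<close>

text \<open>The integrand of the hockey-stick divergences. For \<open>\<gamma> \<ge> 1\<close> its
  \<open>\<nu>\<close>-integral at \<open>u = g z\<close> is the divergence of \<open>\<mu>\<close>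
  from \<open>\<nu>\<close> at level \<open>\<gamma>\<close>. For \<open>0 < \<gamma> < 1\<close> it
  is \<open>\<gamma>\<close> times the divergence with the two measures exchanged, at level
  \<open>1 / \<gamma>\<close>. The switch at 1 gives \<open>gap \<gamma> 1 = 0\<close> for every
  \<open>\<gamma>\<close>.\<close>

definition gap :: "real \<Rightarrow> real \<Rightarrow> real" where
  "gap \<gamma> u = (if 1 \<le> \<gamma> then max 0 (u - \<gamma>) else max 0 (\<gamma> - u))"

lemma gap_nonneg: "0 \<le> gap \<gamma> u"
  by (simp add: gap_def)

lemma gap_measurable[measurable]: "(\<lambda>(\<gamma>, u). gap \<gamma> u) \<in> borel_measurable (borel \<Otimes>\<^sub>M borel)"
  unfolding gap_def by measurable

text \<open>The generator of an f-divergence, built as a mixture of hockey-stick integrands with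
  weight \<open>1 / \<gamma>\<close>. All of \<open>{0<..}\<close> produces relative entropy, and
  \<open>{b..}\<close> isolates large likelihood ratios.\<close>

definition gap_div :: "real set \<Rightarrow> real \<Rightarrow> ennreal" where
  "gap_div \<Gamma> u = (\<integral>\<^sup>+\<gamma>. ennreal (gap \<gamma> u / \<gamma>) * indicator \<Gamma> \<gamma> \<partial>lborel)"

lemma nn_integral_gap_div:
  assumes [measurable]: "\<Gamma> \<in> sets borel" "g \<in> borel_measurable \<nu>" and "sigma_finite_measure \<nu>"
  shows "(\<integral>\<^sup>+z. gap_div \<Gamma> (g z) \<partial>\<nu>) = (\<integral>\<^sup>+\<gamma>. (\<integral>\<^sup>+z. ennreal (gap \<gamma> (g z) / \<gamma>) \<partial>\<nu>) * indicator \<Gamma> \<gamma> \<partial>lborel)"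
proof -
  interpret pair_sigma_finite \<nu> lborel
    by (intro pair_sigma_finite.intro assms(3) sigma_finite_lborel)
  have "(\<integral>\<^sup>+z. gap_div \<Gamma> (g z) \<partial>\<nu>)
      = (\<integral>\<^sup>+\<gamma>. \<integral>\<^sup>+z. ennreal (gap \<gamma> (g z) / \<gamma>) * indicator \<Gamma> \<gamma> \<partial>\<nu> \<partial>lborel)"
    unfolding gap_div_def by (rule Fubini'[symmetric]) measurable
  also have "\<dots> = (\<integral>\<^sup>+\<gamma>. (\<integral>\<^sup>+z. ennreal (gap \<gamma> (g z) / \<gamma>) \<partial>\<nu>) * indicator \<Gamma> \<gamma> \<partial>lborel)"
    by (intro nn_integral_cong nn_integral_multc) measurable
  finally show ?thesis .
qed

text \<open>For each \<open>u\<close> the integrand lives between \<open>u\<close> and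
  \<open>1\<close>, where it is \<open>u / \<gamma> - 1\<close> or its negative and has an
  elementary antiderivative. The part \<open>- u + 1\<close> integrates to zero over a likelihood
  ratio, which leaves \<open>u * ln u\<close>.\<close>

lemma gap_div_all:
  assumes "0 \<le> u"
  shows "gap_div {0<..} u = ennreal (u * ln u - u + 1)"
proof -
  consider "u = 0" | "0 < u" "u < 1" | "1 \<le> u" using assms by linarith
  then show ?thesis
  proof cases
    case 1
    have "gap_div {0<..} u = (\<integral>\<^sup>+(\<gamma>::real). ennreal 1 * indicator {0..1} \<gamma> \<partial>lborel)"
      unfolding gap_div_def
    proof (rule nn_integral_cong_AE)
      show "AE \<gamma> in lborel. ennreal (gap \<gamma> u / \<gamma>) * indicator {0<..} \<gamma> = ennreal 1 * indicator {0..1} \<gamma>"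
        using AE_lborel_singleton[of 0] AE_lborel_singleton[of 1]
        by eventually_elim (auto simp: 1 gap_def indicator_def)
    qed
    also have "\<dots> = ennreal 1"
      by (subst nn_integral_FTC_Icc[where F = "\<lambda>x. x"]) (auto intro!: derivative_eq_intros)
    finally show ?thesis by (simp add: 1)
  next
    case 2
    \<comment> \<open>At \<open>\<gamma> = 1\<close> the function \<open>gap\<close> has already
      switched to its other branch, so the integrands agree only off that point.\<close>
    have "gap_div {0<..} u = (\<integral>\<^sup>+\<gamma>. ennreal (1 - u / \<gamma>) * indicator {u..1} \<gamma> \<partial>lborel)"
      unfolding gap_div_def
      by (rule nn_integral_cong_AE, rule AE_mp[OF AE_lborel_singleton[of 1]])
         (use 2 in \<open>auto simp: gap_def indicator_def field_simps\<close>)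
    also have "\<dots> = ennreal ((1 - u * ln 1) - (u - u * ln u))"
      by (rule nn_integral_FTC_Icc) (use 2 in \<open>auto intro!: derivative_eq_intros simp: field_simps\<close>)
    finally show ?thesis by (simp add: algebra_simps)
  next
    case 3
    have "gap_div {0<..} u = (\<integral>\<^sup>+\<gamma>. ennreal (u / \<gamma> - 1) * indicator {1..u} \<gamma> \<partial>lborel)"
      unfolding gap_div_def
      by (rule nn_integral_cong_AE, rule AE_I2)
         (use 3 in \<open>auto simp: gap_def indicator_def field_simps\<close>)
    also have "\<dots> = ennreal ((u * ln u - u) - (u * ln 1 - 1))"
      by (rule nn_integral_FTC_Icc) (use 3 in \<open>auto intro!: derivative_eq_intros simp: field_simps\<close>)
    finally show ?thesis by (simp add: algebra_simps)
  qed
qed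

text \<open>For \<open>u \<ge> b\<close> the integral equals
  \<open>u * (ln u - (ln b + 1)) + b\<close>. The level \<open>ln b + 1\<close>, rather than
  \<open>ln b\<close>, absorbs the linear term \<open>- u\<close>. For \<open>u < b\<close> the left
  side vanishes.\<close>

lemma gap_div_tail:
  assumes "1 \<le> b" "0 \<le> u"
  shows "ennreal (u * max 0 (ln u - (ln b + 1))) \<le> gap_div {b..} u"
proof (cases "b \<le> u")
  case True
  have "gap_div {b..} u = (\<integral>\<^sup>+\<gamma>. ennreal (u / \<gamma> - 1) * indicator {b..u} \<gamma> \<partial>lborel)"
    unfolding gap_div_def
    by (rule nn_integral_cong_AE, rule AE_I2)
       (use True assms in \<open>auto simp: gap_def indicator_def field_simps\<close>)
  also have "\<dots> = ennreal ((u * ln u - u) - (u * ln b - b))"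
    by (rule nn_integral_FTC_Icc) (use True assms in \<open>auto intro!: derivative_eq_intros simp: field_simps\<close>)
  finally have eq: "gap_div {b..} u = ennreal ((u * ln u - u) - (u * ln b - b))" .
  show ?thesis
  proof (cases "ln u - (ln b + 1) \<le> 0")
    case False
    then show ?thesis unfolding eq using assms by (intro ennreal_leI) (simp add: algebra_simps)
  qed simp
next
  case False
  then have "ln u \<le> ln b + 1" using assms by (cases "u = 0") (auto intro: order_trans[of _ "ln b"])
  then show ?thesis by simp
qed

lemma gap_div_tail_0:
  assumes "u \<le> b" "1 \<le> b"
  shows "gap_div {b..} u = 0"
proof -
  have "ennreal (gap \<gamma> u / \<gamma>) * indicator {b..} \<gamma> = 0" for \<gamma>
    using assms by (auto simp: gap_def indicator_def)
  then have "gap_div {b..} u = (\<integral>\<^sup>+(\<gamma>::real). 0 \<partial>lborel)"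
    unfolding gap_div_def by (intro nn_integral_cong)
  then show ?thesis by simp
qed

lemma gap_div_mono: "\<Gamma> \<subseteq> \<Gamma>' \<Longrightarrow> gap_div \<Gamma> u \<le> gap_div \<Gamma>' u"
  unfolding gap_div_def by (intro nn_integral_mono mult_left_mono) (auto simp: indicator_def)

lemma gap_div_measurable[measurable]:
  assumes [measurable]: "\<Gamma> \<in> sets borel"
  shows "gap_div \<Gamma> \<in> borel_measurable borel"
  unfolding gap_div_def[abs_def] by measurable

section \<open>Contraction under private kernels\<close>

text \<open>The privacy inequality is applied to the complement of \<open>A\<close> with the two
  points exchanged. Multiplying by \<open>exp (- \<epsilon>)\<close> bounds
  \<open>measure (K x1) A\<close> by \<phi> plus
  \<open>exp (- \<epsilon>) * measure (K x2) A\<close>, and this factor is at most 1. Thus \<phi>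
  bounds the Dobrushin coefficient of the kernel.\<close>

lemma LDP_kernel_dobrushin:
  assumes K: "K \<in> LDP_kernels X Z \<epsilon> \<delta>" and x: "x1 \<in> space X" "x2 \<in> space X" and A: "A \<in> sets Z"
    and "0 \<le> \<epsilon>"
  shows "measure (K x1) A - measure (K x2) A \<le> contraction_coeff \<epsilon> \<delta>"
proof -
  have KX: "K \<in> X \<rightarrow>\<^sub>M prob_algebra Z"
    and ldp: "\<And>x1 x2 A. x1 \<in> space X \<Longrightarrow> x2 \<in> space X \<Longrightarrow> A \<in> sets Z \<Longrightarrow>
      measure (K x1) A - exp \<epsilon> * measure (K x2) A \<le> \<delta>"
    using K by (auto simp: LDP_kernels_def)
  have c: "measure (K x) (space Z - A) = 1 - measure (K x) A" if "x \<in> space X" for x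
  proof -
    have "prob_space (K x)" "sets (K x) = sets Z"
      using measurable_space[OF KX that] by (auto simp: space_prob_algebra)
    then show ?thesis
      using prob_space.prob_compl[of "K x" A] A sets_eq_imp_space_eq[of "K x" Z] by simp
  qed
  define a b where "a = measure (K x1) A" and "b = measure (K x2) A"
  have "1 - b - exp \<epsilon> * (1 - a) \<le> \<delta>"
    using ldp[OF x(2,1), of "space Z - A"] A c[OF x(1)] c[OF x(2)] by (simp add: a_def b_def)
  then have "exp (-\<epsilon>) * (1 - b - \<delta>) \<le> exp (-\<epsilon>) * (exp \<epsilon> * (1 - a))"
    by (intro mult_left_mono) auto
  then have "exp (-\<epsilon>) * (1 - b - \<delta>) \<le> 1 - a"
    by (simp add: mult.assoc[symmetric] exp_minus)
  moreover have "0 \<le> b" by (simp add: b_def)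
  then have "b * exp (-\<epsilon>) \<le> b" using \<open>0 \<le> \<epsilon>\<close> by (intro mult_left_le) auto
  ultimately show ?thesis by (simp add: contraction_coeff_def a_def[symmetric] b_def[symmetric] algebra_simps)
qed

lemma measure_bind_prob_algebra:
  assumes Q: "Q \<in> space (prob_algebra X)" and K: "K \<in> X \<rightarrow>\<^sub>M prob_algebra Z" and A: "A \<in> sets Z"
  shows "measure (Q \<bind> K) A = (\<integral>x. measure (K x) A \<partial>Q)"
proof -
  have "prob_space Q" "sets Q = sets X" using Q by (auto simp: space_prob_algebra)
  then show ?thesis
    using subprob_space.measure_bind[OF prob_space_imp_subprob_space, of Q K Z A]
      measurable_prob_algebraD[OF K] A by (simp cong: measurable_cong_sets)
qed

text \<open>\<open>f\<close> and \<open>g\<close> are the likelihood ratios before and after the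
  channel. Privacy enters only through the total variation bound \<open>\<phi>\<close>.\<close>

locale kernel_pair = P: likelihood_pair P0 P1 f + Q: likelihood_pair "P0 \<bind> K" "P1 \<bind> K" g
  for P0 P1 :: "'x measure" and f and K :: "'x \<Rightarrow> 'z measure" and g +
  fixes X Z \<phi>
  assumes P0: "P0 \<in> space (prob_algebra X)" and P1: "P1 \<in> space (prob_algebra X)"
    and K: "K \<in> X \<rightarrow>\<^sub>M prob_algebra Z"
    and dobrushin: "\<And>x1 x2 A. x1 \<in> space X \<Longrightarrow> x2 \<in> space X \<Longrightarrow> A \<in> sets Z \<Longrightarrow>
      measure (K x1) A - measure (K x2) A \<le> \<phi>"
begin

lemma phi_nonneg: "0 \<le> \<phi>"
proof -
  obtain x where "x \<in> space P1" using P.N.not_empty by auto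
  then have "x \<in> space X" using P1 sets_eq_imp_space_eq[of P1 X] by (auto simp: space_prob_algebra)
  from dobrushin[OF this this, of "{}"] show ?thesis by simp
qed

lemma integrable_gap: "integrable P1 (\<lambda>x. gap \<gamma> (f x))" "integrable (P1 \<bind> K) (\<lambda>z. gap \<gamma> (g z))"
  using P.integrable_g Q.integrable_g by (cases "1 \<le> \<gamma>"; simp add: gap_def)+

text \<open>The output divergence is attained on one event \<open>A\<close>. Pulled back through the
  channel, \<open>A\<close> becomes a function \<open>k\<close> that oscillates by at most
  \<open>\<phi>\<close>, and only this oscillation can tell the sources apart.\<close>

lemma gap_contraction:
  "(\<integral>z. gap \<gamma> (g z) \<partial>(P1 \<bind> K)) \<le> \<phi> * (\<integral>x. gap \<gamma> (f x) \<partial>P1)"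
proof -
  \<comment> \<open>The sign \<open>s\<close> merges the two branches of \<open>gap\<close>, so both
    are handled by one computation.\<close>
  define s :: real where "s = (if 1 \<le> \<gamma> then 1 else -1)"
  have gap: "gap \<gamma> u = max 0 (s * (u - \<gamma>))" for u by (simp add: gap_def s_def)
  have sX: "sets P1 = sets X" "space P1 = space X" "space P0 = space X"
    using P0 P1 sets_eq_imp_space_eq[of P1 X] sets_eq_imp_space_eq[of P0 X] by (auto simp: space_prob_algebra)
  have sZ: "sets (P1 \<bind> K) = sets Z" by (rule sets_bind'[OF P1 K])
  define A where "A = {z \<in> space (P1 \<bind> K). 0 < s * (g z - \<gamma>)}"
  have AQ[measurable]: "A \<in> sets (P1 \<bind> K)" unfolding A_def by measurable
  then have AZ: "A \<in> sets Z" by (simp add: sZ)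
  have AM: "A \<in> sets (P0 \<bind> K)" using AQ by (simp add: Q.sets_eq)
  define k where "k x = measure (K x) A" for x
  have k01: "0 \<le> k x" "k x \<le> 1" if "x \<in> space X" for x
    using measurable_space[OF K that] by (auto simp: k_def space_prob_algebra prob_space.prob_le_1)
  have "k \<in> borel_measurable X"
    unfolding k_def by (rule measurable_compose[OF K measurable_measure_prob_algebra[OF AZ]])
  then have [measurable]: "k \<in> borel_measurable P1" using sX(1) by (simp cong: measurable_cong_sets)
  have ik: "integrable P1 k" by (rule P.N.integrable_const_bound[of _ 1]) (use k01 in \<open>auto simp: sX\<close>)
  have ifk: "integrable P1 (\<lambda>x. f x * k x)"
    by (rule Bochner_Integration.integrable_bound[OF P.integrable_g])
       (use k01 in \<open>auto simp: sX abs_mult P.g_nonneg intro!: AE_I2 mult_left_le\<close>)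
  have m1: "measure (P1 \<bind> K) A = (\<integral>x. k x \<partial>P1)"
    unfolding k_def by (rule measure_bind_prob_algebra[OF P1 K AZ])
  have "measure (P0 \<bind> K) A = (\<integral>x. k x \<partial>P0)"
    unfolding k_def by (rule measure_bind_prob_algebra[OF P0 K AZ])
  also have "\<dots> = (\<integral>x. f x * k x \<partial>P1)"
    unfolding P.density by (subst integral_density) (auto simp: P.g_nonneg)
  finally have m0: "measure (P0 \<bind> K) A = (\<integral>x. f x * k x \<partial>P1)" .
  have igA: "integrable (P1 \<bind> K) (\<lambda>z. g z * indicator A z)"
    using integrable_mult_indicator[OF AQ Q.integrable_g] by (simp add: mult.commute)
  have "measure (P0 \<bind> K) A = (\<integral>z. indicator A z \<partial>(P0 \<bind> K))" using AM by simp
  also have "\<dots> = (\<integral>z. g z * indicator A z \<partial>(P1 \<bind> K))"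
    unfolding Q.density by (subst integral_density) (auto simp: Q.g_nonneg)
  finally have m0': "measure (P0 \<bind> K) A = (\<integral>z. g z * indicator A z \<partial>(P1 \<bind> K))" .
  have "(\<integral>z. gap \<gamma> (g z) \<partial>(P1 \<bind> K)) = (\<integral>z. s * (g z * indicator A z - \<gamma> * indicator A z) \<partial>(P1 \<bind> K))"
    by (rule Bochner_Integration.integral_cong) (auto simp: gap A_def indicator_def max_def)
  also have "\<dots> = s * (measure (P0 \<bind> K) A - \<gamma> * measure (P1 \<bind> K) A)"
    using igA by (simp add: m0' Q.N.emeasure_finite less_top[symmetric])
  also have "\<dots> = (\<integral>x. s * (f x * k x - \<gamma> * k x) \<partial>P1)"
    using ik ifk by (simp add: m0 m1)
  \<comment> \<open>With \<open>a\<close> the infimum of \<open>k\<close>, the value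
    \<open>k x\<close> lies between \<open>a\<close> and \<open>a + \<phi>\<close>. The upper value
    is used where \<open>s * (f x - \<gamma>)\<close> is nonnegative, the lower value where it is
    negative.\<close>
  also have "\<dots> \<le> (\<integral>x. \<phi> * gap \<gamma> (f x) + (INF y\<in>space X. k y) * (s * (f x - \<gamma>)) \<partial>P1)"
  proof (rule integral_mono)
    let ?a = "INF y\<in>space X. k y"
    show "integrable P1 (\<lambda>x. s * (f x * k x - \<gamma> * k x))" using ik ifk by simp
    show "integrable P1 (\<lambda>x. \<phi> * gap \<gamma> (f x) + ?a * (s * (f x - \<gamma>)))"
      using integrable_gap(1)[of \<gamma>] P.integrable_g by simp
    fix x assume "x \<in> space P1"
    then have x: "x \<in> space X" by (simp add: sX)
    have a1: "?a \<le> k x" by (rule cINF_lower[OF _ x]) (use k01 in \<open>auto intro!: bdd_belowI2[where m = 0]\<close>)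
    have "k x - \<phi> \<le> ?a"
      by (rule cINF_greatest) (use x dobrushin[OF x _ AZ] in \<open>auto simp: k_def algebra_simps\<close>)
    then have a2: "k x \<le> ?a + \<phi>" by simp
    have eq: "s * (f x * k x - \<gamma> * k x) = s * (f x - \<gamma>) * k x" by (simp add: algebra_simps)
    show "s * (f x * k x - \<gamma> * k x) \<le> \<phi> * gap \<gamma> (f x) + ?a * (s * (f x - \<gamma>))"
    proof (cases "0 \<le> s * (f x - \<gamma>)")
      case True
      then have "s * (f x - \<gamma>) * k x \<le> s * (f x - \<gamma>) * (?a + \<phi>)" by (intro mult_left_mono a2)
      with True show ?thesis unfolding eq gap by (simp add: algebra_simps)
    next
      case False
      then have "s * (f x - \<gamma>) * k x \<le> s * (f x - \<gamma>) * ?a" by (intro mult_left_mono_neg a1) simp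
      with False show ?thesis unfolding eq gap by (simp add: mult.commute)
    qed
  qed
  also have "\<dots> = \<phi> * (\<integral>x. gap \<gamma> (f x) \<partial>P1) + (INF y\<in>space X. k y) * (s * (1 - \<gamma>))"
    using integrable_gap(1)[of \<gamma>] P.integrable_g by (simp add: P.integral_g P.N.prob_space)
  also have "\<dots> \<le> \<phi> * (\<integral>x. gap \<gamma> (f x) \<partial>P1)"
  proof -
    have "space X \<noteq> {}" using P.N.not_empty by (simp add: sX)
    then have "0 \<le> (INF y\<in>space X. k y)" by (rule cINF_greatest) (use k01 in auto)
    \<comment> \<open>Here the switch of branch at \<open>\<gamma> = 1\<close> matters: it gives the
      constant remainder the right sign on both sides of 1.\<close>
    moreover have "s * (1 - \<gamma>) \<le> 0" by (simp add: s_def)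
    ultimately show ?thesis by (simp add: mult_nonneg_nonpos)
  qed
  finally show ?thesis .
qed

text \<open>Fubini's theorem moves the integral over \<open>\<gamma>\<close> outside, where the
  contraction applies level by level. Positivity of \<open>\<Gamma>\<close> makes
  \<open>1 / \<gamma>\<close> a nonnegative weight.\<close>

lemma gap_div_contraction:
  assumes [measurable]: "\<Gamma> \<in> sets borel" and pos: "\<Gamma> \<subseteq> {0<..}"
  shows "(\<integral>\<^sup>+z. gap_div \<Gamma> (g z) \<partial>(P1 \<bind> K)) \<le> ennreal \<phi> * (\<integral>\<^sup>+x. gap_div \<Gamma> (f x) \<partial>P1)"
proof -
  note eqQ = nn_integral_gap_div[OF assms(1) Q.g_measurable prob_space_imp_sigma_finite[OF Q.N.prob_space_axioms]]
  note eqP = nn_integral_gap_div[OF assms(1) P.g_measurable prob_space_imp_sigma_finite[OF P.N.prob_space_axioms]]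
  have c: "(\<integral>\<^sup>+z. ennreal (gap \<gamma> (g z) / \<gamma>) \<partial>(P1 \<bind> K)) \<le> ennreal \<phi> * (\<integral>\<^sup>+x. ennreal (gap \<gamma> (f x) / \<gamma>) \<partial>P1)"
    if "0 < \<gamma>" for \<gamma>
  proof -
    have "(\<integral>\<^sup>+z. ennreal (gap \<gamma> (g z) / \<gamma>) \<partial>(P1 \<bind> K)) = ennreal (\<integral>z. gap \<gamma> (g z) / \<gamma> \<partial>(P1 \<bind> K))"
      by (rule nn_integral_eq_integral) (use integrable_gap(2)[of \<gamma>] gap_nonneg that in auto)
    also have "\<dots> \<le> ennreal (\<phi> * (\<integral>x. gap \<gamma> (f x) / \<gamma> \<partial>P1))"
      using gap_contraction[of \<gamma>] that by (intro ennreal_leI) (simp add: divide_right_mono)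
    also have "\<dots> = ennreal \<phi> * ennreal (\<integral>x. gap \<gamma> (f x) / \<gamma> \<partial>P1)"
      by (rule ennreal_mult'[OF phi_nonneg])
    also have "ennreal (\<integral>x. gap \<gamma> (f x) / \<gamma> \<partial>P1) = (\<integral>\<^sup>+x. ennreal (gap \<gamma> (f x) / \<gamma>) \<partial>P1)"
      by (rule nn_integral_eq_integral[symmetric]) (use integrable_gap(1)[of \<gamma>] gap_nonneg that in auto)
    finally show ?thesis .
  qed
  have "(\<integral>\<^sup>+z. gap_div \<Gamma> (g z) \<partial>(P1 \<bind> K))
      \<le> (\<integral>\<^sup>+\<gamma>. ennreal \<phi> * ((\<integral>\<^sup>+x. ennreal (gap \<gamma> (f x) / \<gamma>) \<partial>P1) * indicator \<Gamma> \<gamma>) \<partial>lborel)"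
    unfolding eqQ by (intro nn_integral_mono) (use c pos in \<open>auto simp: indicator_def\<close>)
  also have "\<dots> = ennreal \<phi> * (\<integral>\<^sup>+x. gap_div \<Gamma> (f x) \<partial>P1)"
    unfolding eqP by (rule nn_integral_cmult) (simp add: P.N.borel_measurable_nn_integral)
  finally show ?thesis .
qed

end

section \<open>Relative entropy, tails and bounded likelihood ratios for a pair of measures\<close>

lemma likelihood_pair_RN_deriv:
  assumes "prob_space \<mu>" "prob_space \<nu>" and ac: "absolutely_continuous \<nu> \<mu>" and sets: "sets \<mu> = sets \<nu>"
  shows "likelihood_pair \<mu> \<nu> (\<lambda>z. enn2real (RN_deriv \<nu> \<mu> z))"
proof -
  interpret M: prob_space \<mu> by fact
  interpret N: prob_space \<nu> by fact
  \<comment> \<open>Passing to real values changes the density only where it is infinite, a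
    \<open>\<nu>\<close>-null set.\<close>
  have "AE z in \<nu>. RN_deriv \<nu> \<mu> z \<noteq> \<infinity>"
    by (rule N.RN_deriv_finite) (use ac sets in \<open>auto intro: M.sigma_finite_measure_axioms\<close>)
  then have "AE z in \<nu>. ennreal (enn2real (RN_deriv \<nu> \<mu> z)) = RN_deriv \<nu> \<mu> z"
    by eventually_elim (simp add: less_top)
  then have "density \<nu> (\<lambda>z. ennreal (enn2real (RN_deriv \<nu> \<mu> z))) = density \<nu> (RN_deriv \<nu> \<mu>)"
    by (intro density_cong) auto
  also have "\<dots> = \<mu>" by (rule N.density_RN_deriv[OF ac sets])
  finally show ?thesis
    by unfold_locales simp_all
qed

lemma relative_entropy_integrand_nonneg:
  fixes u :: real assumes "0 \<le> u" shows "0 \<le> u * ln u - u + 1"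
proof (cases "u = 0")
  case False
  with assms have u: "0 < u" by simp
  then have "- ln u \<le> 1 / u - 1" using ln_le_minus_one[of "1 / u"] by (simp add: ln_div)
  then have "u * (- ln u) \<le> u * (1 / u - 1)" using u by (intro mult_left_mono) auto
  with u show ?thesis by (simp add: algebra_simps)
qed simp

context likelihood_pair
begin

lemma integral_likelihood:
  assumes [measurable]: "h \<in> borel_measurable \<nu>"
  shows "integrable \<mu> h \<longleftrightarrow> integrable \<nu> (\<lambda>z. g z * h z :: real)"
    and "(\<integral>z. h z \<partial>\<mu>) = (\<integral>z. g z * h z \<partial>\<nu>)"
  unfolding density by (subst integrable_density integral_density; simp add: g_nonneg)+

text \<open>The linear part of the generator cancels because \<open>g\<close> has
  \<open>\<nu>\<close>-mean 1. Nonnegativity of the divergence then follows pointwise from that of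
  the generator.\<close>

lemma nn_integral_gap_div_all:
  assumes i: "integrable \<mu> (\<lambda>z. ln (g z))"
  shows "(\<integral>\<^sup>+z. gap_div {0<..} (g z) \<partial>\<nu>) = ennreal (\<integral>z. ln (g z) \<partial>\<mu>)"
    and "0 \<le> (\<integral>z. ln (g z) \<partial>\<mu>)"
proof -
  have i': "integrable \<nu> (\<lambda>z. g z * ln (g z))" using i by (subst (asm) integral_likelihood) auto
  have "(\<integral>\<^sup>+z. gap_div {0<..} (g z) \<partial>\<nu>) = (\<integral>\<^sup>+z. ennreal (g z * ln (g z) - g z + 1) \<partial>\<nu>)"
    by (simp add: gap_div_all g_nonneg)
  also have "\<dots> = ennreal (\<integral>z. g z * ln (g z) - g z + 1 \<partial>\<nu>)"
    by (rule nn_integral_eq_integral)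
       (use i' integrable_g relative_entropy_integrand_nonneg g_nonneg in auto)
  also have eq: "(\<integral>z. g z * ln (g z) - g z + 1 \<partial>\<nu>) = (\<integral>z. ln (g z) \<partial>\<mu>)"
    using i' integrable_g by (simp add: integral_likelihood(2) integral_g N.prob_space)
  finally show "(\<integral>\<^sup>+z. gap_div {0<..} (g z) \<partial>\<nu>) = ennreal (\<integral>z. ln (g z) \<partial>\<mu>)" .
  show "0 \<le> (\<integral>z. ln (g z) \<partial>\<mu>)"
    unfolding eq[symmetric]
    by (intro Bochner_Integration.integral_nonneg relative_entropy_integrand_nonneg g_nonneg)
qed

text \<open>Dominated convergence: the generator on \<open>{0<..}\<close> dominates and has finite
  integral, and each tail is zero once the level passes \<open>g z\<close>. The index
  \<open>Suc n\<close> keeps the level at least 1.\<close>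

lemma gap_div_tail_tendsto:
  assumes i: "integrable \<mu> (\<lambda>z. ln (g z))"
  shows "(\<lambda>n. \<integral>\<^sup>+z. gap_div {real (Suc n)..} (g z) \<partial>\<nu>) \<longlonglongrightarrow> 0"
proof -
  have "(\<lambda>n. \<integral>\<^sup>+z. gap_div {real (Suc n)..} (g z) \<partial>\<nu>) \<longlonglongrightarrow> (\<integral>\<^sup>+z. 0 \<partial>\<nu>)"
  proof (rule nn_integral_dominated_convergence[where w = "\<lambda>z. gap_div {0<..} (g z)"])
    show "(\<integral>\<^sup>+z. gap_div {0<..} (g z) \<partial>\<nu>) < \<infinity>" by (simp add: nn_integral_gap_div_all(1)[OF i])
    show "AE z in \<nu>. gap_div {real (Suc n)..} (g z) \<le> gap_div {0<..} (g z)" for n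
      by (intro AE_I2 gap_div_mono) auto
    show "AE z in \<nu>. (\<lambda>n. gap_div {real (Suc n)..} (g z)) \<longlonglongrightarrow> 0"
    proof (rule AE_I2)
      fix z
      obtain N where N: "g z \<le> real N" using real_arch_simple by blast
      show "(\<lambda>n. gap_div {real (Suc n)..} (g z)) \<longlonglongrightarrow> 0"
        by (rule tendsto_eventually, rule eventually_sequentiallyI[of N], rule gap_div_tail_0)
           (use N in auto)
    qed
  qed measurable
  then show ?thesis by simp
qed

text \<open>Pointwise \<open>g * trunc_llr c \<le> g * ln g\<close>, which is the entropy generator
  plus \<open>g - 1\<close>, and the latter has \<open>\<nu>\<close>-mean zero. Integrability of the
  generator is read off the finite bound \<open>fin\<close>.\<close>

lemma trunc_llr_integral_le:
  assumes "0 \<le> c" "0 \<le> d" and fin: "(\<integral>\<^sup>+z. gap_div {0<..} (g z) \<partial>\<nu>) \<le> ennreal d"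
  shows "(\<integral>z. trunc_llr c z \<partial>\<mu>) \<le> d"
proof -
  let ?h = "\<lambda>z. g z * ln (g z) - g z + 1"
  have h0: "0 \<le> ?h z" for z by (rule relative_entropy_integrand_nonneg[OF g_nonneg])
  have le: "(\<integral>\<^sup>+z. ennreal (?h z) \<partial>\<nu>) \<le> ennreal d"
    using fin by (simp add: gap_div_all g_nonneg)
  have ih: "integrable \<nu> ?h"
    by (rule integrableI_nonneg) (use h0 le in \<open>auto intro: le_less_trans\<close>)
  have "ennreal (\<integral>z. ?h z \<partial>\<nu>) \<le> ennreal d"
    using le by (subst (asm) nn_integral_eq_integral[OF ih]) (use h0 in auto)
  then have Ih: "(\<integral>z. ?h z \<partial>\<nu>) \<le> d" using \<open>0 \<le> d\<close> by (simp add: ennreal_le_iff)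
  have it: "integrable \<nu> (\<lambda>z. g z * trunc_llr c z)"
    using trunc_llr_integrable[OF \<open>0 \<le> c\<close>] by (subst (asm) integral_likelihood) auto
  have "(\<integral>z. trunc_llr c z \<partial>\<mu>) = (\<integral>z. g z * trunc_llr c z \<partial>\<nu>)"
    by (rule integral_likelihood) measurable
  also have "\<dots> \<le> (\<integral>z. ?h z + (g z - 1) \<partial>\<nu>)"
  proof (rule integral_mono[OF it])
    show "integrable \<nu> (\<lambda>z. ?h z + (g z - 1))"
      by (rule Bochner_Integration.integrable_add[OF ih]) (use integrable_g in auto)
    show "g z * trunc_llr c z \<le> ?h z + (g z - 1)" for z
      using g_nonneg[of z] by (simp add: trunc_llr_def mult_left_mono)
  qed
  also have "\<dots> = (\<integral>z. ?h z \<partial>\<nu>) + (\<integral>z. g z - 1 \<partial>\<nu>)"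
    by (rule Bochner_Integration.integral_add[OF ih]) (use integrable_g in auto)
  also have "(\<integral>z. g z - 1 \<partial>\<nu>) = 0" using integrable_g by (simp add: integral_g N.prob_space)
  finally show ?thesis using Ih by simp
qed

text \<open>Moving the expectation from \<open>\<mu>\<close> to \<open>\<nu>\<close> multiplies the
  excess by \<open>g\<close>, and \<open>gap_div_tail\<close> bounds the product.\<close>

lemma excess_le:
  assumes "1 \<le> b" "0 \<le> r" and tail: "(\<integral>\<^sup>+z. gap_div {b..} (g z) \<partial>\<nu>) \<le> ennreal r"
  shows "integrable \<mu> (\<lambda>z. max 0 (ln (g z) - (ln b + 1)))"
    and "(\<integral>z. max 0 (ln (g z) - (ln b + 1)) \<partial>\<mu>) \<le> r"
proof -
  let ?e = "\<lambda>z. max 0 (ln (g z) - (ln b + 1))"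
  have "(\<integral>\<^sup>+z. ennreal (?e z) \<partial>\<mu>) = (\<integral>\<^sup>+z. ennreal (g z) * ennreal (?e z) \<partial>\<nu>)"
    unfolding density by (subst nn_integral_density) auto
  also have "\<dots> = (\<integral>\<^sup>+z. ennreal (g z * ?e z) \<partial>\<nu>)"
    by (intro nn_integral_cong) (simp add: ennreal_mult g_nonneg)
  also have "\<dots> \<le> (\<integral>\<^sup>+z. gap_div {b..} (g z) \<partial>\<nu>)"
    by (intro nn_integral_mono gap_div_tail assms g_nonneg)
  finally have le: "(\<integral>\<^sup>+z. ennreal (?e z) \<partial>\<mu>) \<le> ennreal r" using tail by simp
  show i: "integrable \<mu> ?e"
    by (rule integrableI_nonneg) (use le in \<open>auto intro: le_less_trans\<close>)
  have "ennreal (\<integral>z. ?e z \<partial>\<mu>) \<le> ennreal r"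
    using le by (subst (asm) nn_integral_eq_integral[OF i]) auto
  then show "(\<integral>z. ?e z \<partial>\<mu>) \<le> r" using \<open>0 \<le> r\<close> by (simp add: ennreal_le_iff)
qed

text \<open>The hypothesis is tested on the event where \<open>g\<close> exceeds
  \<open>exp \<epsilon>\<close>: the positive part of \<open>g - exp \<epsilon>\<close> then has
  integral at most zero and vanishes almost everywhere.\<close>

lemma bounded_likelihood:
  assumes b: "\<And>A. A \<in> sets \<nu> \<Longrightarrow> measure \<mu> A \<le> exp \<epsilon> * measure \<nu> A"
  shows "AE z in \<mu>. ln (g z) \<le> \<epsilon>"
proof -
  let ?A = "{z \<in> space \<nu>. exp \<epsilon> < g z}"
  have A: "?A \<in> sets \<nu>" by measurable
  have igA: "integrable \<nu> (\<lambda>z. g z * indicator ?A z)"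
    using integrable_mult_indicator[OF A integrable_g] by (simp only: real_scaleR_def mult.commute)
  have "measure \<mu> ?A = (\<integral>z. indicator ?A z \<partial>\<mu>)" using A by (simp add: sets_eq)
  also have "\<dots> = (\<integral>z. g z * indicator ?A z \<partial>\<nu>)"
    by (rule integral_likelihood) (use A in measurable)
  finally have mA: "measure \<mu> ?A = (\<integral>z. g z * indicator ?A z \<partial>\<nu>)" .
  have i: "integrable \<nu> (\<lambda>z. max 0 (g z - exp \<epsilon>))" using integrable_g by simp
  have iA: "integrable \<nu> (\<lambda>z. exp \<epsilon> * indicator ?A z)"
    using A by (simp add: N.emeasure_finite less_top[symmetric])
  have "(\<integral>z. max 0 (g z - exp \<epsilon>) \<partial>\<nu>) = (\<integral>z. g z * indicator ?A z - exp \<epsilon> * indicator ?A z \<partial>\<nu>)"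
    by (rule Bochner_Integration.integral_cong) (auto simp: indicator_def)
  also have "\<dots> = measure \<mu> ?A - exp \<epsilon> * measure \<nu> ?A"
    using Bochner_Integration.integral_diff[OF igA iA] A by (simp add: mA)
  also have "\<dots> \<le> 0" using b[OF A] by simp
  finally have "(\<integral>z. max 0 (g z - exp \<epsilon>) \<partial>\<nu>) = 0" by (intro antisym) auto
  then have "AE z in \<nu>. max 0 (g z - exp \<epsilon>) = 0"
    using integral_nonneg_eq_0_iff_AE[OF i] by simp
  then have "AE z in \<mu>. g z \<le> exp \<epsilon>"
    unfolding density by (subst AE_density) auto
  with AE_g_pos show ?thesis
    by eventually_elim (metis exp_le_cancel_iff exp_ln)
qed

end

section \<open>Decision rules and the uniform error exponent\<close>

lemma private_law_eq:
  assumes "Q \<in> space (prob_algebra X)" "K \<in> X \<rightarrow>\<^sub>M prob_algebra Z"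
  shows "private_law n K Q = PiM {..<n} (\<lambda>_. Q \<bind> K)"
  unfolding private_law_def by (rule PiM_bind_kernel[OF assms]) simp

lemma product_in_prob_algebra:
  assumes "Q \<in> space (prob_algebra X)" "K \<in> X \<rightarrow>\<^sub>M prob_algebra Z"
  shows "PiM {..<n} (\<lambda>_. Q \<bind> K) \<in> space (prob_algebra (PiM {..<n} (\<lambda>_. Z)))"
  using prob_space_bind'[OF assms] sets_bind'[OF assms]
  by (auto simp: space_prob_algebra intro!: prob_space_PiM sets_PiM_cong)

lemma decision_prob_eq:
  assumes Q: "Q \<in> space (prob_algebra X)" and K: "K \<in> X \<rightarrow>\<^sub>M prob_algebra Z"
    and W: "W \<in> decision_rules n Z" and t: "t \<in> {0, 1}"
  shows "decision_prob n K W Q t = (\<integral>z. measure (W z) {t} \<partial>PiM {..<n} (\<lambda>_. Q \<bind> K))"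
  unfolding decision_prob_def private_law_eq[OF Q K]
  by (rule measure_bind_prob_algebra[OF product_in_prob_algebra[OF Q K]])
     (use W t in \<open>auto simp: decision_rules_def\<close>)

lemma decision_rule_compl:
  assumes W: "W \<in> decision_rules n Z" and z: "z \<in> space (PiM {..<n} (\<lambda>_. Z))"
  shows "measure (W z) {1} = 1 - measure (W z) {0}"
proof -
  have "prob_space (W z)" and sets: "sets (W z) = sets (count_space {0, 1})"
    using measurable_space[OF W[unfolded decision_rules_def] z] by (simp_all add: space_prob_algebra)
  then have Wz: "prob_space (W z)" "sets (W z) = Pow {0, 1}" "space (W z) = {0, 1}"
    using sets_eq_imp_space_eq[OF sets] by simp_all
  have "{1::nat} = space (W z) - {0}" by (auto simp: Wz)
  then show ?thesis using prob_space.prob_compl[OF Wz(1), of "{0}"] by (simp add: Wz)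
qed

lemma measurable_decision_rule:
  assumes "W \<in> decision_rules n Z"
  shows "(\<lambda>z. measure (W z) {0}) \<in> borel_measurable (PiM {..<n} (\<lambda>_. Z))"
  by (rule measurable_compose[OF assms[unfolded decision_rules_def] measurable_measure_prob_algebra]) simp

text \<open>The deterministic rule with acceptance region \<open>A\<close> for the null hypothesis,
  encoded as a point mass so that it is a randomised rule.\<close>

definition region_rule :: "(nat \<Rightarrow> 'z) set \<Rightarrow> (nat \<Rightarrow> 'z) \<Rightarrow> nat measure" where
  "region_rule A z = return (count_space {0, 1}) (if z \<in> A then 0 else 1)"

lemma region_rule:
  assumes "A \<in> sets (PiM {..<n} (\<lambda>_. Z))"
  shows "region_rule A \<in> decision_rules n Z"
  unfolding decision_rules_def region_rule_def
  by (rule measurable_compose[OF _ measurable_return_prob_space])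
     (use assms in \<open>auto intro!: measurable_If_set\<close>)

lemma decision_prob_region:
  assumes Q: "Q \<in> space (prob_algebra X)" and K: "K \<in> X \<rightarrow>\<^sub>M prob_algebra Z"
    and A: "A \<in> sets (PiM {..<n} (\<lambda>_. Z))"
  shows "decision_prob n K (region_rule A) Q 0 = measure (PiM {..<n} (\<lambda>_. Q \<bind> K)) A"
    and "decision_prob n K (region_rule A) Q 1 = 1 - measure (PiM {..<n} (\<lambda>_. Q \<bind> K)) A"
proof -
  let ?P = "PiM {..<n} (\<lambda>_. Q \<bind> K)"
  have P: "prob_space ?P" "sets ?P = sets (PiM {..<n} (\<lambda>_. Z))"
    using product_in_prob_algebra[OF Q K, of n] unfolding space_prob_algebra by blast+
  interpret P: prob_space ?P by (rule P)
  have AP: "A \<in> sets ?P" using A unfolding P(2) .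
  have eq: "measure (region_rule A z) {0} = indicator A z"
    "measure (region_rule A z) {1} = indicator (space ?P - A) z" if "z \<in> space ?P" for z
    using that unfolding region_rule_def by (auto simp: measure_return indicator_def)
  have "decision_prob n K (region_rule A) Q 0 = (\<integral>z. indicator A z \<partial>?P)"
    by (subst decision_prob_eq[OF Q K region_rule[OF A]])
       (rule insertI1, rule Bochner_Integration.integral_cong[OF refl eq(1)])
  also have "\<dots> = measure ?P A"
    unfolding Bochner_Integration.integral_indicator Int_absorb2[OF sets.sets_into_space[OF AP]] ..
  finally show "decision_prob n K (region_rule A) Q 0 = measure ?P A" .
  have "decision_prob n K (region_rule A) Q 1 = (\<integral>z. indicator (space ?P - A) z \<partial>?P)"
    by (subst decision_prob_eq[OF Q K region_rule[OF A]])
       (rule insertI2[OF insertI1], rule Bochner_Integration.integral_cong[OF refl eq(2)])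
  also have "\<dots> = measure ?P (space ?P - A)"
    unfolding Bochner_Integration.integral_indicator Int_absorb2[OF Diff_subset] ..
  also have "\<dots> = 1 - measure ?P A" by (rule P.prob_compl[OF AP])
  finally show "decision_prob n K (region_rule A) Q 1 = 1 - measure ?P A" .
qed

section \<open>The error exponent of a family of channels\<close>

lemma ext_ln_ge: "0 < a \<Longrightarrow> ereal a \<le> x \<Longrightarrow> ereal (ln a) \<le> ext_ln x"
  by (cases x) (auto simp: ext_ln_def)

lemma ext_ln_le: "0 < a \<Longrightarrow> x \<le> ereal a \<Longrightarrow> ext_ln x \<le> ereal (ln a)"
  by (cases x) (auto simp: ext_ln_def)

lemma error_rate_ge:
  assumes "0 < n" "0 < a" "ereal a \<le> opt_tradeoff X Z P0 P1 \<epsilon> \<delta> n \<alpha>"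
  shows "ereal (ln a / real n) \<le> error_rate X Z P0 P1 \<epsilon> \<delta> \<alpha> n"
  using ereal_mult_left_mono[OF ext_ln_ge[OF assms(2,3)], of "ereal (1 / real n)"] by (simp add: error_rate_def)

lemma error_rate_le:
  assumes "0 < n" "0 < a" "opt_tradeoff X Z P0 P1 \<epsilon> \<delta> n \<alpha> \<le> ereal a"
  shows "error_rate X Z P0 P1 \<epsilon> \<delta> \<alpha> n \<le> ereal (ln a / real n)"
  using ereal_mult_left_mono[OF ext_ln_le[OF assms(2,3)], of "ereal (1 / real n)"] by (simp add: error_rate_def)

lemma eventually_divide_real_le:
  assumes "0 < e"
  shows "\<forall>\<^sub>F n in sequentially. a / real n \<le> e"
proof -
  have "(\<lambda>n. a / real n) \<longlonglongrightarrow> 0" by real_asymp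
  from order_tendstoD(2)[OF this assms] show ?thesis by eventually_elim simp
qed

text \<open>The interface between the channel estimates and the exponent. \<open>trunc_le\<close>
  bounds the candidate exponents, and \<open>unif\<close> makes the upper tails of the
  log-likelihood ratios small uniformly over kernels. It is instantiated for finite divergence and
  for \<open>\<delta> = 0\<close>.\<close>

locale channel_family =
  fixes X :: "'x measure" and Z :: "'z measure" and P0 P1 :: "'x measure" and \<alpha> \<epsilon> \<delta> :: real
    and g :: "('x \<Rightarrow> 'z measure) \<Rightarrow> 'z \<Rightarrow> real" and Smax :: real
  assumes P0: "P0 \<in> space (prob_algebra X)" and P1: "P1 \<in> space (prob_algebra X)"
    and \<alpha>: "0 < \<alpha>" "\<alpha> < 1"
    and pair: "\<And>K. K \<in> LDP_kernels X Z \<epsilon> \<delta> \<Longrightarrow> likelihood_pair (P0 \<bind> K) (P1 \<bind> K) (g K)"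
    and nonempty: "LDP_kernels X Z \<epsilon> \<delta> \<noteq> {}"
    and trunc_le: "\<And>K c. K \<in> LDP_kernels X Z \<epsilon> \<delta> \<Longrightarrow> 0 \<le> c \<Longrightarrow>
      (\<integral>z. min (ln (g K z)) c \<partial>(P0 \<bind> K)) \<le> Smax"
    and unif: "\<And>r. 0 < r \<Longrightarrow> \<exists>c\<ge>0. \<forall>K\<in>LDP_kernels X Z \<epsilon> \<delta>.
      integrable (P0 \<bind> K) (\<lambda>z. max 0 (ln (g K z) - c)) \<and>
      (\<integral>z. max 0 (ln (g K z) - c) \<partial>(P0 \<bind> K)) \<le> r"
begin

lemma kernel_measurable: "K \<in> LDP_kernels X Z \<epsilon> \<delta> \<Longrightarrow> K \<in> X \<rightarrow>\<^sub>M prob_algebra Z"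
  by (simp add: LDP_kernels_def)

text \<open>By monotone convergence in \<open>c\<close>, this is the supremum over private kernels
  of the Kullback-Leibler divergence between the two channel outputs.\<close>

definition S :: real where
  "S = (SUP (K, c)\<in>LDP_kernels X Z \<epsilon> \<delta> \<times> {0..}. \<integral>z. min (ln (g K z)) c \<partial>(P0 \<bind> K))"

lemma S_upper:
  assumes "K \<in> LDP_kernels X Z \<epsilon> \<delta>" "0 \<le> c"
  shows "(\<integral>z. min (ln (g K z)) c \<partial>(P0 \<bind> K)) \<le> S"
proof -
  have "bdd_above ((\<lambda>(K, c). \<integral>z. min (ln (g K z)) c \<partial>(P0 \<bind> K)) ` (LDP_kernels X Z \<epsilon> \<delta> \<times> {0..}))"
    by (rule bdd_aboveI2[where M = Smax]) (use trunc_le in auto)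
  from cSUP_upper[OF _ this, of "(K, c)"] assms show ?thesis by (simp add: S_def)
qed

lemma S_le: "S \<le> Smax"
  unfolding S_def by (rule cSUP_least) (use nonempty trunc_le in auto)

lemma S_approx:
  assumes "r < S"
  obtains K c where "K \<in> LDP_kernels X Z \<epsilon> \<delta>" "0 \<le> c" "r < (\<integral>z. min (ln (g K z)) c \<partial>(P0 \<bind> K))"
proof -
  have "\<exists>y\<in>(\<lambda>(K, c). \<integral>z. min (ln (g K z)) c \<partial>(P0 \<bind> K)) ` (LDP_kernels X Z \<epsilon> \<delta> \<times> {0..}). r < y"
    by (rule less_cSupE[OF assms[unfolded S_def]]) (use nonempty in auto)
  with that show ?thesis by auto
qed

text \<open>The strong converse is applied to all kernels with the same \<open>c\<close>, so the
  resulting lower bound on the second error survives the infimum over kernels at each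
  \<open>n\<close>.\<close>

lemma error_rate_lower:
  assumes \<eta>: "0 < \<eta>"
  shows "\<forall>\<^sub>F n in sequentially. ereal (- S - \<eta>) \<le> error_rate X Z P0 P1 \<epsilon> \<delta> \<alpha> n"
proof -
  \<comment> \<open>The strong converse loses \<open>2 * \<theta> = \<eta> / 2\<close> in the
    exponent; the other half of \<open>\<eta>\<close> absorbs \<open>ln \<beta> / n\<close>. The
    acceptance probability is at least \<open>1 - \<alpha> = 2 * \<beta>\<close>, of which
    \<open>\<beta>\<close> is spent on the error terms, half on Chebyshev's and half on Markov's
    bound.\<close>
  define \<theta> where "\<theta> = \<eta> / 4"
  define \<beta> where "\<beta> = (1 - \<alpha>) / 2"
  have \<theta>: "0 < \<theta>" and \<beta>: "0 < \<beta>" using \<eta> \<alpha> by (auto simp: \<theta>_def \<beta>_def)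
  obtain c where c: "0 \<le> c" and unif_c: "\<forall>K\<in>LDP_kernels X Z \<epsilon> \<delta>.
      integrable (P0 \<bind> K) (\<lambda>z. max 0 (ln (g K z) - c)) \<and>
      (\<integral>z. max 0 (ln (g K z) - c) \<partial>(P0 \<bind> K)) \<le> \<theta> * \<beta> / 2"
    using unif[of "\<theta> * \<beta> / 2"] \<theta> \<beta> by auto
  have "\<forall>\<^sub>F n in sequentially. ((c\<^sup>2 + 2) / \<theta>\<^sup>2) / real n \<le> \<beta> / 2"
    using \<beta> by (intro eventually_divide_real_le) simp
  moreover have "\<forall>\<^sub>F n in sequentially. (- ln \<beta>) / real n \<le> \<eta> / 2"
    using \<eta> by (intro eventually_divide_real_le) simp
  ultimately show ?thesis using eventually_gt_at_top[of 0]
  proof eventually_elim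
    case (elim n)
    define a where "a = \<beta> * exp (- (real n * (S + 2 * \<theta>)))"
    have "ereal a \<le> opt_tradeoff X Z P0 P1 \<epsilon> \<delta> n \<alpha>"
      unfolding opt_tradeoff_def
    proof (intro INF_greatest)
      fix K W assume KL: "K \<in> LDP_kernels X Z \<epsilon> \<delta>"
        and "W \<in> {W \<in> decision_rules n Z. decision_prob n K W P0 1 \<le> \<alpha>}"
      then have W: "W \<in> decision_rules n Z" and type1: "decision_prob n K W P0 1 \<le> \<alpha>" by auto
      note K = kernel_measurable[OF KL]
      interpret L: likelihood_pair "P0 \<bind> K" "P1 \<bind> K" "g K" by (rule pair[OF KL])
      interpret Mn: prob_space "L.Mn n" by (rule L.prob_space_Mn)
      define w where "w z = measure (W z) {0}" for z
      have sets: "sets (L.Nn n) = sets (PiM {..<n} (\<lambda>_. Z))"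
        unfolding L.Nn_def by (rule sets_PiM_cong) (simp_all add: sets_bind'[OF P1 K])
      have sp: "space (L.Nn n) = space (PiM {..<n} (\<lambda>_. Z))" "space (L.Mn n) = space (PiM {..<n} (\<lambda>_. Z))"
        using sets_eq_imp_space_eq[OF sets] sets_eq_imp_space_eq[OF L.sets_Mn[of n]] by auto
      have wm: "w \<in> borel_measurable (L.Nn n)" "w \<in> borel_measurable (L.Mn n)"
        using measurable_decision_rule[OF W] unfolding w_def
        by (simp_all cong: measurable_cong_sets add: sets L.sets_Mn)
      have w01: "0 \<le> w z \<and> w z \<le> 1" if "z \<in> space (PiM {..<n} (\<lambda>_. Z))" for z
        using decision_rule_compl[OF W that] measure_nonneg[of "W z" "{1}"] unfolding w_def by simp
      have iw: "integrable (L.Mn n) w"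
        by (rule Mn.integrable_const_bound[of _ 1]) (use w01 wm in \<open>auto simp: sp\<close>)
      have d0: "decision_prob n K W P1 0 = (\<integral>z. w z \<partial>L.Nn n)"
        unfolding w_def L.Nn_def by (rule decision_prob_eq[OF P1 K W]) simp
      have "decision_prob n K W P0 1 = (\<integral>z. measure (W z) {1} \<partial>L.Mn n)"
        unfolding L.Mn_def by (rule decision_prob_eq[OF P0 K W]) simp
      also have "\<dots> = (\<integral>z. 1 - w z \<partial>L.Mn n)"
        by (rule Bochner_Integration.integral_cong) (use decision_rule_compl[OF W] in \<open>auto simp: sp w_def\<close>)
      also have "\<dots> = 1 - (\<integral>z. w z \<partial>L.Mn n)" using iw by (simp add: Mn.prob_space)
      finally have "1 - \<alpha> \<le> (\<integral>z. w z \<partial>L.Mn n)" using type1 by simp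
      also have "\<dots> \<le> exp (real n * (S + 2 * \<theta>)) * (\<integral>z. w z \<partial>L.Nn n)
          + ((c\<^sup>2 + 2) / (real n * \<theta>\<^sup>2) + (\<theta> * \<beta> / 2) / \<theta>)"
        by (rule L.strong_converse)
           (use c S_upper[OF KL c] unif_c KL \<theta> elim wm w01 in \<open>auto simp: L.trunc_llr_def sp\<close>)
      also have "(c\<^sup>2 + 2) / (real n * \<theta>\<^sup>2) + (\<theta> * \<beta> / 2) / \<theta> \<le> \<beta>"
        using elim(1) \<theta> by (simp add: field_simps)
      finally have "\<beta> \<le> exp (real n * (S + 2 * \<theta>)) * (\<integral>z. w z \<partial>L.Nn n)" by (simp add: \<beta>_def field_simps)
      then have "a \<le> exp (- (real n * (S + 2 * \<theta>))) * (exp (real n * (S + 2 * \<theta>)) * (\<integral>z. w z \<partial>L.Nn n))"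
        unfolding a_def by (simp add: mult.commute[of \<beta>])
      then have "a \<le> (\<integral>z. w z \<partial>L.Nn n)" by (simp add: mult.assoc[symmetric] exp_minus)
      then show "ereal a \<le> ereal (decision_prob n K W P1 0)" by (simp add: d0)
    qed
    moreover have "0 < a" using \<beta> by (simp add: a_def)
    ultimately have "ereal (ln a / real n) \<le> error_rate X Z P0 P1 \<epsilon> \<delta> \<alpha> n"
      using elim by (intro error_rate_ge)
    moreover have "ln a = ln \<beta> - real n * (S + 2 * \<theta>)" using \<beta> by (simp add: a_def ln_mult)
    then have "ln a / real n = ln \<beta> / real n - (S + \<eta> / 2)"
      using elim by (simp add: diff_divide_distrib \<theta>_def)
    then have "- S - \<eta> \<le> ln a / real n" using elim(2) by simp
    ultimately show ?case by (meson ereal_less_eq(3) order_trans)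
  qed
qed

text \<open>One nearly optimal kernel and level, fixed for all \<open>n\<close>, suffice: the
  likelihood ratio test with exponent \<open>S - \<eta>\<close> has first error tending to zero,
  hence eventually at most \<open>\<alpha>\<close>.\<close>

lemma error_rate_upper:
  assumes \<eta>: "0 < \<eta>"
  shows "\<forall>\<^sub>F n in sequentially. error_rate X Z P0 P1 \<epsilon> \<delta> \<alpha> n \<le> ereal (- S + \<eta>)"
proof -
  obtain K c where KL: "K \<in> LDP_kernels X Z \<epsilon> \<delta>" and c: "0 \<le> c"
    and r: "S - \<eta> < (\<integral>z. min (ln (g K z)) c \<partial>(P0 \<bind> K))"
    using S_approx[of "S - \<eta>"] \<eta> by auto
  note K = kernel_measurable[OF KL]
  interpret L: likelihood_pair "P0 \<bind> K" "P1 \<bind> K" "g K" by (rule pair[OF KL])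
  define m where "m = (\<integral>z. L.trunc_llr c z \<partial>(P0 \<bind> K))"
  have r': "S - \<eta> < m" using r by (simp add: m_def L.trunc_llr_def)
  have "\<forall>\<^sub>F n in sequentially. ((c\<^sup>2 + 2) / (m - (S - \<eta>))\<^sup>2) / real n \<le> \<alpha>"
    using \<alpha> by (intro eventually_divide_real_le)
  then show ?thesis using eventually_gt_at_top[of 0]
  proof eventually_elim
    case (elim n)
    define A where "A = {z \<in> space (L.Nn n). exp (real n * (S - \<eta>)) \<le> (\<Prod>i<n. g K (z i))}"
    have sets: "sets (L.Nn n) = sets (PiM {..<n} (\<lambda>_. Z))"
      unfolding L.Nn_def by (rule sets_PiM_cong) (simp_all add: sets_bind'[OF P1 K])
    have "A \<in> sets (L.Nn n)" unfolding A_def by measurable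
    then have AZ: "A \<in> sets (PiM {..<n} (\<lambda>_. Z))" by (simp add: sets)
    note ach = L.achievability[OF c r'[unfolded m_def] elim(2), folded A_def m_def]
    have "decision_prob n K (region_rule A) P0 1 = 1 - measure (L.Mn n) A"
      unfolding L.Mn_def by (rule decision_prob_region(2)[OF P0 K AZ])
    also have "\<dots> \<le> (c\<^sup>2 + 2) / (real n * (m - (S - \<eta>))\<^sup>2)" by (rule ach(2))
    also have "\<dots> \<le> \<alpha>" using elim(1) by (simp add: mult.commute)
    finally have W: "region_rule A \<in> {W \<in> decision_rules n Z. decision_prob n K W P0 1 \<le> \<alpha>}"
      using region_rule[OF AZ] by simp
    have "opt_tradeoff X Z P0 P1 \<epsilon> \<delta> n \<alpha> \<le> ereal (decision_prob n K (region_rule A) P1 0)"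
      unfolding opt_tradeoff_def by (rule INF_lower2[OF KL], rule INF_lower[OF W])
    also have "decision_prob n K (region_rule A) P1 0 = measure (L.Nn n) A"
      unfolding L.Nn_def by (rule decision_prob_region(1)[OF P1 K AZ])
    also have "ereal \<dots> \<le> ereal (exp (- (real n * (S - \<eta>))))" using ach(1) by simp
    finally have "error_rate X Z P0 P1 \<epsilon> \<delta> \<alpha> n \<le> ereal (ln (exp (- (real n * (S - \<eta>)))) / real n)"
      using elim by (intro error_rate_le) auto
    also have "ln (exp (- (real n * (S - \<eta>)))) / real n = - S + \<eta>" using elim by simp
    finally show ?case .
  qed
qed

theorem error_rate_tendsto: "error_rate X Z P0 P1 \<epsilon> \<delta> \<alpha> \<longlonglongrightarrow> ereal (- S)"
proof (rule order_tendstoI)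
  fix a assume "a < ereal (- S)"
  then obtain b where b: "a < ereal b" "b < - S" using ereal_dense2 by (metis ereal_less(1) less_ereal.simps(1))
  from error_rate_lower[of "- S - b"] b(2)
  have "\<forall>\<^sub>F n in sequentially. ereal b \<le> error_rate X Z P0 P1 \<epsilon> \<delta> \<alpha> n" by simp
  then show "\<forall>\<^sub>F n in sequentially. a < error_rate X Z P0 P1 \<epsilon> \<delta> \<alpha> n"
    by eventually_elim (use b(1) in order)
next
  fix a assume "ereal (- S) < a"
  then obtain b where b: "ereal b < a" "- S < b" using ereal_dense2 by (metis less_ereal.simps(1))
  from error_rate_upper[of "b + S"] b(2)
  have "\<forall>\<^sub>F n in sequentially. error_rate X Z P0 P1 \<epsilon> \<delta> \<alpha> n \<le> ereal b" by simp
  then show "\<forall>\<^sub>F n in sequentially. error_rate X Z P0 P1 \<epsilon> \<delta> \<alpha> n < a"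
    by eventually_elim (use b(1) in order)
qed

end

section \<open>The two cases of finite exponent\<close>

text \<open>A set is null for the output law exactly when almost every input gives it mass zero, and
  the latter property passes from \<open>P1\<close> to \<open>P0\<close>.\<close>

lemma absolutely_continuous_bind:
  assumes P0: "P0 \<in> space (prob_algebra X)" and P1: "P1 \<in> space (prob_algebra X)"
    and K: "K \<in> X \<rightarrow>\<^sub>M prob_algebra Z" and ac: "absolutely_continuous P1 P0"
  shows "absolutely_continuous (P1 \<bind> K) (P0 \<bind> K)"
  unfolding absolutely_continuous_def
proof
  fix A assume "A \<in> null_sets (P1 \<bind> K)"
  then have A: "A \<in> sets Z" and 0: "emeasure (P1 \<bind> K) A = 0"
    using sets_bind'[OF P1 K] by (auto simp: null_sets_def)
  have sP: "sets P0 = sets X" "sets P1 = sets X" using P0 P1 by (simp_all add: space_prob_algebra)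
  have m: "(\<lambda>x. emeasure (K x) A) \<in> borel_measurable X"
    by (rule measurable_compose[OF measurable_prob_algebraD[OF K] measurable_emeasure_subprob_algebra[OF A]])
  have m1: "(\<lambda>x. emeasure (K x) A) \<in> borel_measurable P1"
    and m0: "(\<lambda>x. emeasure (K x) A) \<in> borel_measurable P0"
    using m by (simp_all cong: measurable_cong_sets add: sP)
  have "AE x in P1. emeasure (K x) A = 0"
    using 0 unfolding emeasure_bind_prob_algebra[OF P1 K A] nn_integral_0_iff_AE[OF m1] .
  then have "AE x in P0. emeasure (K x) A = 0"
    by (rule absolutely_continuous_AE[rotated 2]) (use ac sP in simp_all)
  then have "emeasure (P0 \<bind> K) A = 0"
    unfolding emeasure_bind_prob_algebra[OF P0 K A] nn_integral_0_iff_AE[OF m0] .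
  then show "A \<in> null_sets (P0 \<bind> K)" using A sets_bind'[OF P0 K] by (simp add: null_sets_def)
qed

lemma bind_likelihood_pair:
  assumes P0: "P0 \<in> space (prob_algebra X)" and P1: "P1 \<in> space (prob_algebra X)"
    and K: "K \<in> X \<rightarrow>\<^sub>M prob_algebra Z" and ac: "absolutely_continuous (P1 \<bind> K) (P0 \<bind> K)"
  shows "likelihood_pair (P0 \<bind> K) (P1 \<bind> K) (\<lambda>z. enn2real (RN_deriv (P1 \<bind> K) (P0 \<bind> K) z))"
  by (rule likelihood_pair_RN_deriv)
     (use prob_space_bind'[OF P0 K] prob_space_bind'[OF P1 K] sets_bind'[OF P0 K] sets_bind'[OF P1 K] ac in simp_all)

text \<open>The privacy inequality is averaged over \<open>x2\<close> under \<open>P1\<close> and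
  then over \<open>x1\<close> under \<open>P0\<close>. The outputs thus become comparable even for
  mutually singular sources.\<close>

lemma pure_LDP_bound:
  assumes P0: "P0 \<in> space (prob_algebra X)" and P1: "P1 \<in> space (prob_algebra X)"
    and KL: "K \<in> LDP_kernels X Z \<epsilon> 0" and A: "A \<in> sets Z"
  shows "measure (P0 \<bind> K) A \<le> exp \<epsilon> * measure (P1 \<bind> K) A"
proof -
  have K: "K \<in> X \<rightarrow>\<^sub>M prob_algebra Z"
    and ldp: "\<And>x1 x2. x1 \<in> space X \<Longrightarrow> x2 \<in> space X \<Longrightarrow> measure (K x1) A \<le> exp \<epsilon> * measure (K x2) A"
    using KL A by (auto simp: LDP_kernels_def)
  have sP: "sets P0 = sets X" "sets P1 = sets X" using P0 P1 by (simp_all add: space_prob_algebra)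
  have spP: "space P0 = space X" "space P1 = space X" using sP[THEN sets_eq_imp_space_eq] .
  interpret P0: prob_space P0 using P0 by (simp add: space_prob_algebra)
  interpret P1: prob_space P1 using P1 by (simp add: space_prob_algebra)
  have m: "(\<lambda>x. measure (K x) A) \<in> borel_measurable X"
    by (rule measurable_compose[OF K measurable_measure_prob_algebra[OF A]])
  have le1: "measure (K x) A \<le> 1" if "x \<in> space X" for x
    using measurable_space[OF K that] by (simp add: space_prob_algebra prob_space.prob_le_1)
  have i1: "integrable P1 (\<lambda>x. measure (K x) A)"
    by (rule P1.integrable_const_bound[of _ 1]) (use le1 m in \<open>auto simp: spP sP cong: measurable_cong_sets\<close>)
  have i0: "integrable P0 (\<lambda>x. measure (K x) A)"
    by (rule P0.integrable_const_bound[of _ 1]) (use le1 m in \<open>auto simp: spP sP cong: measurable_cong_sets\<close>)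
  note eq = measure_bind_prob_algebra[OF P0 K A] measure_bind_prob_algebra[OF P1 K A]
  have "measure (K x) A \<le> exp \<epsilon> * measure (P1 \<bind> K) A" if "x \<in> space X" for x
  proof -
    have "(\<integral>y. measure (K x) A \<partial>P1) \<le> (\<integral>y. exp \<epsilon> * measure (K y) A \<partial>P1)"
      by (rule integral_mono) (use i1 ldp[OF that] in \<open>auto simp: spP\<close>)
    then show ?thesis by (simp add: eq P1.prob_space)
  qed
  then have "(\<integral>x. measure (K x) A \<partial>P0) \<le> (\<integral>x. exp \<epsilon> * measure (P1 \<bind> K) A \<partial>P0)"
    by (intro integral_mono i0) (auto simp: spP)
  then show ?thesis by (simp add: eq(1) P0.prob_space)
qed

abbreviation channel_lr :: "'x measure \<Rightarrow> 'x measure \<Rightarrow> ('x \<Rightarrow> 'z measure) \<Rightarrow> 'z \<Rightarrow> real" where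
  "channel_lr P0 P1 K \<equiv> \<lambda>z. enn2real (RN_deriv (P1 \<bind> K) (P0 \<bind> K) z)"

lemma pure_LDP_likelihood:
  assumes P0: "P0 \<in> space (prob_algebra X)" and P1: "P1 \<in> space (prob_algebra X)"
    and KL: "K \<in> LDP_kernels X Z \<epsilon> 0"
  shows "likelihood_pair (P0 \<bind> K) (P1 \<bind> K) (channel_lr P0 P1 K)"
    and "AE z in P0 \<bind> K. ln (channel_lr P0 P1 K z) \<le> \<epsilon>"
proof -
  have K: "K \<in> X \<rightarrow>\<^sub>M prob_algebra Z" using KL by (simp add: LDP_kernels_def)
  note s = sets_bind'[OF P0 K] sets_bind'[OF P1 K]
  interpret M0: prob_space "P0 \<bind> K" by (rule prob_space_bind'[OF P0 K])
  have "absolutely_continuous (P1 \<bind> K) (P0 \<bind> K)"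
    unfolding absolutely_continuous_def
  proof
    fix A assume "A \<in> null_sets (P1 \<bind> K)"
    then have A: "A \<in> sets Z" and "measure (P1 \<bind> K) A = 0"
      by (auto simp: null_sets_def s measure_def)
    with pure_LDP_bound[OF P0 P1 KL A] have "measure (P0 \<bind> K) A = 0"
      by (intro antisym) auto
    with A show "A \<in> null_sets (P0 \<bind> K)" by (simp add: null_sets_def s M0.emeasure_eq_measure)
  qed
  from bind_likelihood_pair[OF P0 P1 K this]
  show pair: "likelihood_pair (P0 \<bind> K) (P1 \<bind> K) (channel_lr P0 P1 K)" .
  show "AE z in P0 \<bind> K. ln (channel_lr P0 P1 K z) \<le> \<epsilon>"
    by (rule likelihood_pair.bounded_likelihood[OF pair]) (use pure_LDP_bound[OF P0 P1 KL] s in auto)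
qed

text \<open>With \<open>\<delta> = 0\<close> the privacy constraint itself bounds the log-likelihood
  ratio by \<open>\<epsilon>\<close>, so the exponent is finite even when the source divergence is
  infinite.\<close>

lemma channel_family_pure:
  assumes P0: "P0 \<in> space (prob_algebra X)" and P1: "P1 \<in> space (prob_algebra X)"
    and "0 < \<alpha>" "\<alpha> < 1" "0 \<le> \<epsilon>" and ne: "LDP_kernels X Z \<epsilon> 0 \<noteq> {}"
  shows "channel_family X Z P0 P1 \<alpha> \<epsilon> 0 (channel_lr P0 P1) \<epsilon>"
proof (rule channel_family.intro)
  show "likelihood_pair (P0 \<bind> K) (P1 \<bind> K) (channel_lr P0 P1 K)"
    if "K \<in> LDP_kernels X Z \<epsilon> 0" for K
    by (rule pure_LDP_likelihood[OF P0 P1 that])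
  show "(\<integral>z. min (ln (channel_lr P0 P1 K z)) c \<partial>(P0 \<bind> K)) \<le> \<epsilon>"
    if KL: "K \<in> LDP_kernels X Z \<epsilon> 0" and "0 \<le> c" for K c
  proof -
    interpret L: likelihood_pair "P0 \<bind> K" "P1 \<bind> K" "channel_lr P0 P1 K"
      by (rule pure_LDP_likelihood[OF P0 P1 KL])
    have "(\<integral>z. L.trunc_llr c z \<partial>(P0 \<bind> K)) \<le> (\<integral>z. \<epsilon> \<partial>(P0 \<bind> K))"
    proof (rule integral_mono_AE)
      show "AE z in P0 \<bind> K. L.trunc_llr c z \<le> \<epsilon>"
        using pure_LDP_likelihood(2)[OF P0 P1 KL]
        by eventually_elim (simp add: L.trunc_llr_def min.coboundedI1)
    qed (use L.trunc_llr_integrable[OF \<open>0 \<le> c\<close>] in simp_all)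
    then show ?thesis by (simp add: L.trunc_llr_def L.M.prob_space)
  qed
  show "\<exists>c\<ge>0. \<forall>K\<in>LDP_kernels X Z \<epsilon> 0.
      integrable (P0 \<bind> K) (\<lambda>z. max 0 (ln (channel_lr P0 P1 K z) - c)) \<and>
      (\<integral>z. max 0 (ln (channel_lr P0 P1 K z) - c) \<partial>(P0 \<bind> K)) \<le> r" if "0 < r" for r
  \<comment> \<open>At the level \<open>\<epsilon>\<close> the excess vanishes almost everywhere,
    for every kernel.\<close>
  proof (intro exI[of _ \<epsilon>] conjI ballI \<open>0 \<le> \<epsilon>\<close>)
    fix K assume KL: "K \<in> LDP_kernels X Z \<epsilon> 0"
    interpret L: likelihood_pair "P0 \<bind> K" "P1 \<bind> K" "channel_lr P0 P1 K"
      by (rule pure_LDP_likelihood[OF P0 P1 KL])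
    let ?e = "\<lambda>z. max 0 (ln (channel_lr P0 P1 K z) - \<epsilon>)"
    have [measurable]: "?e \<in> borel_measurable (P0 \<bind> K)"
      using L.g_measurable' by measurable
    have 0: "AE z in P0 \<bind> K. ?e z = 0"
      using pure_LDP_likelihood(2)[OF P0 P1 KL] by eventually_elim simp
    show "integrable (P0 \<bind> K) ?e"
      by (subst integrable_cong_AE[OF _ _ 0]) simp_all
    show "(\<integral>z. ?e z \<partial>(P0 \<bind> K)) \<le> r"
      by (subst integral_cong_AE[OF _ _ 0]) (use that in simp_all)
  qed
qed (use assms in auto)

text \<open>Strict positivity serves the case of infinite divergence:
  \<open>0 * \<infinity> = 0\<close> in \<open>ereal\<close>, so the bound is
  \<open>-\<infinity>\<close> there only for a positive coefficient.\<close>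

lemma contraction_coeff_bounds:
  assumes "0 \<le> \<epsilon>" "0 \<le> \<delta>" "\<delta> \<le> 1"
  shows "0 \<le> contraction_coeff \<epsilon> \<delta>" "contraction_coeff \<epsilon> \<delta> \<le> 1"
    and "0 < \<epsilon> \<or> 0 < \<delta> \<Longrightarrow> 0 < contraction_coeff \<epsilon> \<delta>"
proof -
  show "0 \<le> contraction_coeff \<epsilon> \<delta>"
    using mult_mono[of "1 - \<delta>" 1 "exp (-\<epsilon>)" 1] assms by (simp add: contraction_coeff_def)
  show "contraction_coeff \<epsilon> \<delta> \<le> 1" using assms by (simp add: contraction_coeff_def)
  assume "0 < \<epsilon> \<or> 0 < \<delta>"
  then show "0 < contraction_coeff \<epsilon> \<delta>"
  proof
    assume "0 < \<epsilon>"
    then have "(1 - \<delta>) * exp (-\<epsilon>) \<le> exp (-\<epsilon>)" "exp (-\<epsilon>) < 1"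
      using assms by (auto intro: mult_left_le_one_le)
    then show ?thesis unfolding contraction_coeff_def by linarith
  next
    assume "0 < \<delta>"
    moreover have "(1 - \<delta>) * exp (-\<epsilon>) \<le> (1 - \<delta>) * 1" using assms by (intro mult_left_mono) auto
    ultimately show ?thesis by (simp add: contraction_coeff_def)
  qed
qed

text \<open>Both uniform bounds come from the source pair through
  \<open>gap_div_contraction\<close>: on \<open>{0<..}\<close> it gives the exponent bound, on
  \<open>{b..}\<close> it transfers the vanishing source tail to all outputs.\<close>

lemma channel_family_finite_KL:
  assumes P0: "P0 \<in> space (prob_algebra X)" and P1: "P1 \<in> space (prob_algebra X)"
    and "0 < \<alpha>" "\<alpha> < 1" and \<epsilon>\<delta>: "0 \<le> \<epsilon>" "0 \<le> \<delta>" "\<delta> \<le> 1" and ne: "LDP_kernels X Z \<epsilon> \<delta> \<noteq> {}"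
    and KL: "ext_KL P0 P1 = ereal d"
  shows "channel_family X Z P0 P1 \<alpha> \<epsilon> \<delta> (channel_lr P0 P1) (contraction_coeff \<epsilon> \<delta> * d)"
proof -
  define f where "f x = enn2real (RN_deriv P1 P0 x)" for x
  define \<phi> where "\<phi> = contraction_coeff \<epsilon> \<delta>"
  note \<phi> = contraction_coeff_bounds(1,2)[OF \<epsilon>\<delta>, folded \<phi>_def]
  have "entropy_density (exp 1) P1 P0 = (\<lambda>x. ln (f x))"
    by (simp add: entropy_density_def f_def log_def fun_eq_iff)
  with KL have ac: "absolutely_continuous P1 P0" and lnf: "integrable P0 (\<lambda>x. ln (f x))"
    and d: "d = (\<integral>x. ln (f x) \<partial>P0)"
    by (auto simp: ext_KL_def KL_divergence_def split: if_splits)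
  have P: "likelihood_pair P0 P1 f"
    unfolding f_def[abs_def]
    by (rule likelihood_pair_RN_deriv) (use P0 P1 ac in \<open>simp_all add: space_prob_algebra\<close>)
  interpret P: likelihood_pair P0 P1 f by (rule P)
  have kp: "kernel_pair P0 P1 f K (channel_lr P0 P1 K) X Z \<phi>" if K': "K \<in> LDP_kernels X Z \<epsilon> \<delta>" for K
  proof -
    have K: "K \<in> X \<rightarrow>\<^sub>M prob_algebra Z" using K' by (simp add: LDP_kernels_def)
    show ?thesis
      by (intro kernel_pair.intro kernel_pair_axioms.intro P P0 P1 K
          bind_likelihood_pair[OF P0 P1 K absolutely_continuous_bind[OF P0 P1 K ac]]
          LDP_kernel_dobrushin[OF K', folded \<phi>_def] \<open>0 \<le> \<epsilon>\<close>)
  qed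
  have d0: "0 \<le> d" unfolding d by (rule P.nn_integral_gap_div_all(2)[OF lnf])
  show ?thesis
    unfolding \<phi>_def[symmetric]
  proof (rule channel_family.intro)
    show "likelihood_pair (P0 \<bind> K) (P1 \<bind> K) (channel_lr P0 P1 K)"
      if "K \<in> LDP_kernels X Z \<epsilon> \<delta>" for K
      using kp[OF that] by (rule kernel_pair.axioms(2))
    show "(\<integral>z. min (ln (channel_lr P0 P1 K z)) c \<partial>(P0 \<bind> K)) \<le> \<phi> * d"
      if K: "K \<in> LDP_kernels X Z \<epsilon> \<delta>" and "0 \<le> c" for K c
    proof -
      interpret K: kernel_pair P0 P1 f K "channel_lr P0 P1 K" X Z \<phi> by (rule kp[OF K])
      have "(\<integral>\<^sup>+z. gap_div {0<..} (channel_lr P0 P1 K z) \<partial>(P1 \<bind> K)) \<le> ennreal (\<phi> * d)"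
        using K.gap_div_contraction[of "{0<..}"] P.nn_integral_gap_div_all(1)[OF lnf]
        by (simp add: d ennreal_mult' \<phi>(1))
      from K.Q.trunc_llr_integral_le[OF \<open>0 \<le> c\<close> _ this] show ?thesis
        using \<phi>(1) d0 by (simp add: K.Q.trunc_llr_def)
    qed
    show "\<exists>c\<ge>0. \<forall>K\<in>LDP_kernels X Z \<epsilon> \<delta>.
        integrable (P0 \<bind> K) (\<lambda>z. max 0 (ln (channel_lr P0 P1 K z) - c)) \<and>
        (\<integral>z. max 0 (ln (channel_lr P0 P1 K z) - c) \<partial>(P0 \<bind> K)) \<le> r" if r: "0 < r" for r
    proof -
      have "\<forall>\<^sub>F n in sequentially. (\<integral>\<^sup>+x. gap_div {real (Suc n)..} (f x) \<partial>P1) < ennreal r"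
        using r by (intro order_tendstoD(2)[OF P.gap_div_tail_tendsto[OF lnf]]) simp
      then obtain n where n: "(\<integral>\<^sup>+x. gap_div {real (Suc n)..} (f x) \<partial>P1) < ennreal r"
        by (auto simp: eventually_sequentially)
      \<comment> \<open>The level is chosen from the source pair alone, so it serves all kernels at
        once.\<close>
      define b where "b = real (Suc n)"
      have b: "1 \<le> b" by (simp add: b_def)
      show ?thesis
      proof (intro exI[of _ "ln b + 1"] conjI ballI)
        show "0 \<le> ln b + 1" using ln_ge_zero[OF b] by simp
        fix K assume K: "K \<in> LDP_kernels X Z \<epsilon> \<delta>"
        interpret K: kernel_pair P0 P1 f K "channel_lr P0 P1 K" X Z \<phi> by (rule kp[OF K])
        have "(\<integral>\<^sup>+z. gap_div {b..} (channel_lr P0 P1 K z) \<partial>(P1 \<bind> K))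
            \<le> ennreal \<phi> * (\<integral>\<^sup>+x. gap_div {b..} (f x) \<partial>P1)"
          by (rule K.gap_div_contraction) (use b in auto)
        also have "\<dots> \<le> 1 * ennreal r"
          using n \<phi>(2) by (intro mult_mono) (auto simp: b_def)
        finally have "(\<integral>\<^sup>+z. gap_div {b..} (channel_lr P0 P1 K z) \<partial>(P1 \<bind> K)) \<le> ennreal r" by simp
        from K.Q.excess_le[OF b less_imp_le[OF r] this]
        show "integrable (P0 \<bind> K) (\<lambda>z. max 0 (ln (channel_lr P0 P1 K z) - (ln b + 1)))"
          and "(\<integral>z. max 0 (ln (channel_lr P0 P1 K z) - (ln b + 1)) \<partial>(P0 \<bind> K)) \<le> r" .
      qed
    qed
  qed (use assms in auto)
qed

lemma channel_family_conclusion: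
  assumes "channel_family X Z P0 P1 \<alpha> \<epsilon> \<delta> g Smax"
  shows "ereal (- Smax) \<le> liminf (error_rate X Z P0 P1 \<epsilon> \<delta> \<alpha>)"
    and "convergent (error_rate X Z P0 P1 \<epsilon> \<delta> \<alpha>)"
proof -
  interpret channel_family X Z P0 P1 \<alpha> \<epsilon> \<delta> g Smax by fact
  have "liminf (error_rate X Z P0 P1 \<epsilon> \<delta> \<alpha>) = ereal (- S)"
    by (rule lim_imp_Liminf[OF _ error_rate_tendsto]) simp
  then show "ereal (- Smax) \<le> liminf (error_rate X Z P0 P1 \<epsilon> \<delta> \<alpha>)" using S_le by simp
  show "convergent (error_rate X Z P0 P1 \<epsilon> \<delta> \<alpha>)"
    using error_rate_tendsto by (rule convergentI)
qed

text \<open>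
  If \<open>space Z\<close> is empty there are no kernels at all, and the infimum over the empty family is \<open>\<infinity>\<close>.
\<close>

lemma error_rate_no_kernels:
  assumes "LDP_kernels X Z \<epsilon> \<delta> = {}"
  shows "error_rate X Z P0 P1 \<epsilon> \<delta> \<alpha> \<longlonglongrightarrow> \<infinity>"
proof (rule tendsto_eventually)
  show "\<forall>\<^sub>F n in sequentially. error_rate X Z P0 P1 \<epsilon> \<delta> \<alpha> n = \<infinity>"
    using eventually_gt_at_top[of 0]
    by eventually_elim (simp add: error_rate_def opt_tradeoff_def assms ext_ln_def top_ereal_def)
qed

theorem corollary4:
  fixes X :: "'x measure" and Z :: "'z measure"
    and P0 P1 :: "'x measure" and \<alpha> \<epsilon> \<delta> :: real
  assumes "P0 \<in> space (prob_algebra X)" and "P1 \<in> space (prob_algebra X)"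
    and "0 < \<alpha>" and "\<alpha> < 1" and "0 \<le> \<epsilon>" and "0 \<le> \<delta>" and "\<delta> \<le> 1"
  shows "liminf (error_rate X Z P0 P1 \<epsilon> \<delta> \<alpha>) \<ge> - (ereal (contraction_coeff \<epsilon> \<delta>) * ext_KL P0 P1)
    \<and> (ext_KL P0 P1 \<noteq> \<infinity> \<or> \<delta> = 0 \<longrightarrow> convergent (error_rate X Z P0 P1 \<epsilon> \<delta> \<alpha>))"
proof (cases "LDP_kernels X Z \<epsilon> \<delta> = {}")
  case True
  note lim = error_rate_no_kernels[OF True, of P0 P1 \<alpha>]
  have "liminf (error_rate X Z P0 P1 \<epsilon> \<delta> \<alpha>) = \<infinity>" by (rule lim_imp_Liminf[OF _ lim]) simp
  with convergentI[OF lim] show ?thesis by simp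
next
  case ne: False
  show ?thesis
  proof (cases "ext_KL P0 P1 = \<infinity>")
    case False
    then have d: "ext_KL P0 P1 = ereal (KL_divergence (exp 1) P1 P0)" by (auto simp: ext_KL_def split: if_splits)
    from channel_family_conclusion[OF channel_family_finite_KL[OF assms ne d]]
    show ?thesis by (simp add: d)
  next
    case inf: True
    have bound: "- (ereal (contraction_coeff \<epsilon> \<delta>) * ext_KL P0 P1) = -\<infinity>" if "0 < \<epsilon> \<or> 0 < \<delta>"
      using contraction_coeff_bounds(3)[OF assms(5-7) that] by (simp add: inf)
    show ?thesis
    proof (cases "\<delta> = 0")
      case True
      note con = channel_family_conclusion[OF channel_family_pure[OF assms(1-5) ne[unfolded True]]]
      show ?thesis
      proof (cases "\<epsilon> = 0")
        \<comment> \<open>The coefficient vanishes and \<open>0 * \<infinity> = 0\<close>, so the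
          claim is the substantial bound \<open>0\<close>; it holds because the pure family has
          \<open>Smax = \<epsilon> = 0\<close>.\<close>
        case True
        with \<open>\<delta> = 0\<close> con show ?thesis by (simp add: contraction_coeff_def flip: zero_ereal_def)
      next
        case False
        with assms(5) have pos: "0 < \<epsilon> \<or> 0 < \<delta>" by simp
        from con(2) show ?thesis unfolding bound[OF pos] using \<open>\<delta> = 0\<close> by simp
      qed
    next
      case False
      with assms(6) have pos: "0 < \<epsilon> \<or> 0 < \<delta>" by simp
      show ?thesis unfolding bound[OF pos] using inf False by simp
    qed
  qed
qed

end
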